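(* Let $d>3$. If a finite $d$-ball packing is Apollonian, then its tangency graph is the graph of a stacked $(d+1)$-polytope.
   Context: A $d$-ball in $\hat{\mathbb R}^d$ is a closed ball, closed exterior of an open ball with $\infty$, or a closed half-space with $\infty$; a $d$-ball packing is a collection of $d$-balls with disjoint interiors; its tangency graph joins balls meeting in exactly one point. A Descartes configuration in dimension $d$ is a set of $d+2$ pairwise tangent $d$-balls with disjoint interiors. A collection of $d$-balls is Apollonian if it can be built from a Descartes configuration by repeatedly adding, for some $d+1$ pairwise tangent balls already present, a new ball tangent to all of them. A stacked polytope is one obtained from a simplex by repeatedly gluing a new simplex onto a facet. *)

theory Defs
  imports "HOL-Analysis.Analysis"
begin

text \<open>Points of the one-point compactification of R^d: Some x is the point x, None is infinity.
  Here d = CARD('n).\<close>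

definition ext_interior :: "('a::real_normed_vector) option set \<Rightarrow> 'a option set" where
  "ext_interior S =
     Some ` interior {x. Some x \<in> S} \<union>
     (if None \<in> S \<and> (\<exists>r. \<forall>x. r < norm x \<longrightarrow> Some x \<in> S) then {None} else {})"

definition dball :: "(real^'n) option set \<Rightarrow> bool" where
  "dball B \<longleftrightarrow>
     (\<exists>c r. r > 0 \<and> B = Some ` cball c r) \<or>
     (\<exists>c r. r > 0 \<and> B = insert None (Some ` {x. r \<le> dist c x})) \<or>
     (\<exists>a b. a \<noteq> 0 \<and> B = insert None (Some ` {x. a \<bullet> x \<le> b}))"

definition ball_packing :: "(real^'n) option set set \<Rightarrow> bool" where
  "ball_packing P \<longleftrightarrow> (\<forall>B\<in>P. dball B) \<and>
     pairwise (\<lambda>A B. ext_interior A \<inter> ext_interior B = {}) P"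

definition tangent :: "'a set \<Rightarrow> 'a set \<Rightarrow> bool" where
  "tangent A B \<longleftrightarrow> (\<exists>!p. p \<in> A \<inter> B)"

definition descartes_config :: "(real^'n) option set set \<Rightarrow> bool" where
  "descartes_config D \<longleftrightarrow> card D = CARD('n) + 2 \<and> ball_packing D \<and> pairwise tangent D"

inductive apollonian :: "(real^'n) option set set \<Rightarrow> bool" where
  start: "descartes_config D \<Longrightarrow> apollonian D"
| step: "\<lbrakk> apollonian S; T \<subseteq> S; card T = CARD('n) + 1; pairwise tangent T;
           dball B; B \<notin> S; \<forall>A\<in>T. tangent A B \<rbrakk> \<Longrightarrow> apollonian (insert B S)"

text \<open>Stacked polytopes (full-dimensional in real^'m): start from a simplex, and repeatedly
  glue a simplex onto a facet F, i.e. add a point v beyond F and beneath all other facets.\<close>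
definition beyond_facet :: "('a::euclidean_space) \<Rightarrow> 'a set \<Rightarrow> 'a set \<Rightarrow> bool" where
  "beyond_facet v F P \<longleftrightarrow> (\<exists>a b. a \<noteq> 0 \<and> P \<subseteq> {x. a \<bullet> x \<le> b} \<and> F \<subseteq> {x. a \<bullet> x = b} \<and> a \<bullet> v > b)"

definition beneath_facet :: "('a::euclidean_space) \<Rightarrow> 'a set \<Rightarrow> 'a set \<Rightarrow> bool" where
  "beneath_facet v F P \<longleftrightarrow> (\<exists>a b. a \<noteq> 0 \<and> P \<subseteq> {x. a \<bullet> x \<le> b} \<and> F \<subseteq> {x. a \<bullet> x = b} \<and> a \<bullet> v < b)"

inductive stacked_polytope :: "(real^'m) set \<Rightarrow> bool" where
  simplex: "\<lbrakk> \<not> affine_dependent S; card S = CARD('m) + 1 \<rbrakk> \<Longrightarrow> stacked_polytope (convex hull S)"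
| stack: "\<lbrakk> stacked_polytope P; F facet_of P; beyond_facet v F P;
            \<forall>G. G facet_of P \<and> G \<noteq> F \<longrightarrow> beneath_facet v G P \<rbrakk>
          \<Longrightarrow> stacked_polytope (convex hull (insert v P))"

definition tangency_graph_iso_polytope_graph ::
  "'b set set \<Rightarrow> ('a::euclidean_space) set \<Rightarrow> bool" where
  "tangency_graph_iso_polytope_graph Pk P \<longleftrightarrow>
     (\<exists>f. bij_betw f Pk {v. v extreme_point_of P} \<and>
          (\<forall>A\<in>Pk. \<forall>B\<in>Pk. A \<noteq> B \<longrightarrow>
              (tangent A B \<longleftrightarrow> (convex hull {f A, f B}) edge_of P)))"

end

theory Submission
  imports Defs "HOL-Computational_Algebra.Primes"
begin

text \<open>
  Balls correspond to unit vectors of a Lorentzian space of dimension \<open>d + 2\<close>, and two touching balls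
  with disjoint interiors have product \<open>-1\<close>. A Descartes configuration is therefore a basis with a
  fixed Gram matrix, and \<open>d + 1\<close> pairwise tangent balls \<open>T\<close> have exactly two common tangent balls
  \<open>k\<close> and \<open>c\<close>, related by \<open>c = 2 / (d - 1) * \<Sum>T - k\<close>.
  For \<open>d > 3\<close> the coefficient \<open>2 / (d - 1)\<close> is not an integer. Fix a ball \<open>A\<close> and walk through
  Descartes configurations away from \<open>A\<close> without backtracking: the product of \<open>A\<close> with the newest
  ball has a denominator that grows \<open>p\<close>-adically for a suitable prime \<open>p\<close>, so it is never \<open>-1\<close>. Hence a
  new ball is tangent to precisely the \<open>d + 1\<close> balls that it was attached to, and adding it to
  the tangency graph amounts to stacking a vertex onto the corresponding facet.
\<close>

section \<open>Balls as Lorentz vectors\<close>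

text \<open>A new ball is prescribed to touch \<open>d + 1\<close> balls, and nothing in the
  construction forbids accidental contact with others. Excluding such contacts is the main obstacle.
  The exchange relation is linear, so it passes to the numbers
  \<open>h X = - lor (lvec A) (lvec X)\<close> for a fixed ball \<open>A\<close>: contact of
  \<open>X\<close> with \<open>A\<close> would force \<open>h X = 1\<close>. If a walk starts by
  removing \<open>A\<close>, its initial values are \<open>-1\<close> at \<open>A\<close> and
  \<open>1\<close> elsewhere, which leaves pure arithmetic of rational numbers. For
  \<open>d = 2\<close> and \<open>d = 3\<close> the coefficient is \<open>2\<close> and
  \<open>1\<close>, so no denominator arises. The second obligation is that the \<open>d + 1\<close>
  balls \<open>T\<close> span a facet when the new vertex is stacked. If \<open>T\<close> already
  lay in two Descartes configurations, a third common tangent ball would coincide with one of the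
  two completing balls. So \<open>T\<close> lies in exactly one configuration, and the cliques with
  this property are the ones that span facets of the polytope built so far.\<close>

definition lor :: "real \<times> 'a::real_inner \<times> real \<Rightarrow> real \<times> 'a \<times> real \<Rightarrow> real" where
  "lor v w = fst (snd v) \<bullet> fst (snd w) - (fst v * snd (snd w) + fst w * snd (snd v)) / 2"

text \<open>This is \<open>-2 * lor v (1, x, x \<bullet> x)\<close>, where
  \<open>(1, x, x \<bullet> x)\<close> is the light-like vector representing the point
  \<open>x\<close>. Infinity is represented by \<open>(0, 0, 1)\<close>, and
  \<open>-2 * lor v (0, 0, 1) = fst v\<close>, so the sign of \<open>fst v\<close> decides whether
  infinity belongs to the ball.\<close>

definition quad :: "real \<times> 'a::real_inner \<times> real \<Rightarrow> 'a \<Rightarrow> real" where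
  "quad v x = fst v * (x \<bullet> x) - 2 * (fst (snd v) \<bullet> x) + snd (snd v)"

text \<open>The ball with centre \<open>c\<close> and radius \<open>r\<close> is encoded by \<open>(1/r, c/r, (c \<bullet> c - r\<^sup>2)/r)\<close>; negative \<open>r\<close>
  gives exteriors of balls, and first component \<open>0\<close> gives half-spaces.\<close>
definition lball :: "real \<times> 'a::real_inner \<times> real \<Rightarrow> 'a option set" where
  "lball v = Some ` {x. quad v x \<le> 0} \<union> (if fst v \<le> 0 then {None} else {})"

lemma lor_commute: "lor v w = lor w v"
  by (simp add: lor_def inner_commute)

lemma lor_add_right: "lor v (w + w') = lor v w + lor v w'"
  by (simp add: lor_def inner_add_right algebra_simps add_divide_distrib)

lemma lor_scaleR_right: "lor v (c *\<^sub>R w) = c * lor v w"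
  by (simp add: lor_def algebra_simps)

lemma lor_diff_right: "lor v (w - w') = lor v w - lor v w'"
  using lor_add_right[of v "w - w'" w'] by simp

lemma lor_zero_right: "lor v 0 = 0"
  by (simp add: lor_def)

lemma lor_sum_right: "lor v (\<Sum>i\<in>I. g i) = (\<Sum>i\<in>I. lor v (g i))"
  by (induction I rule: infinite_finite_induct) (simp_all add: lor_zero_right lor_add_right)

lemma dball_lball:
  assumes "dball B"
  shows "\<exists>v. lor v v = 1 \<and> B = lball v"
proof -
  consider (ball) c r where "r > 0" "B = Some ` cball c r"
    | (ext) c r where "r > 0" "B = insert None (Some ` {x. r \<le> dist c x})"
    | (half) a b where "a \<noteq> 0" "B = insert None (Some ` {x. a \<bullet> x \<le> b})"
    using assms unfolding dball_def by blast
  then show ?thesis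
  proof cases
    case ball
    let ?v = "(1 / r, (1 / r) *\<^sub>R c, (c \<bullet> c - r\<^sup>2) / r)"
    have "quad ?v x = (dist c x ^ 2 - r\<^sup>2) / r" for x
      using ball(1) by (simp add: quad_def dist_norm power2_norm_eq_inner inner_diff inner_commute field_simps)
    then have "quad ?v x \<le> 0 \<longleftrightarrow> dist c x \<le> r" for x
      using ball(1) by (simp add: divide_le_0_iff)
    moreover have "lor ?v ?v = 1"
      using ball(1) by (simp add: lor_def field_simps power2_eq_square)
    ultimately show ?thesis
      using ball by (intro exI[of _ ?v]) (auto simp: lball_def)
  next
    case ext
    let ?v = "(- 1 / r, (- 1 / r) *\<^sub>R c, (r\<^sup>2 - c \<bullet> c) / r)"
    have "quad ?v x = (r\<^sup>2 - dist c x ^ 2) / r" for x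
      using ext(1) by (simp add: quad_def dist_norm power2_norm_eq_inner inner_diff inner_commute field_simps)
    then have "quad ?v x \<le> 0 \<longleftrightarrow> r \<le> dist c x" for x
      using ext(1) by (simp add: divide_le_0_iff)
    moreover have "lor ?v ?v = 1"
      using ext(1) by (simp add: lor_def field_simps power2_eq_square)
    ultimately show ?thesis
      using ext by (intro exI[of _ ?v]) (auto simp: lball_def)
  next
    case half
    let ?v = "(0 :: real, (- 1 / norm a) *\<^sub>R a, - 2 * b / norm a)"
    have "quad ?v x = 2 * (a \<bullet> x - b) / norm a" for x
      using half(1) by (simp add: quad_def field_simps)
    then have "quad ?v x \<le> 0 \<longleftrightarrow> a \<bullet> x \<le> b" for x
      using half(1) by (simp add: divide_le_0_iff)
    moreover have "lor ?v ?v = 1"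
      using half(1) by (simp add: lor_def field_simps dot_square_norm power2_eq_square)
    ultimately show ?thesis
      using half by (intro exI[of _ ?v]) (auto simp: lball_def)
  qed
qed

definition lvec :: "(real^'n) option set \<Rightarrow> real \<times> (real^'n) \<times> real" where
  "lvec B = (SOME v. lor v v = 1 \<and> B = lball v)"

lemma lvec:
  assumes "dball B"
  shows "lor (lvec B) (lvec B) = 1" "lball (lvec B) = B"
  using someI_ex[OF dball_lball[OF assms]] unfolding lvec_def by auto

section \<open>Touching balls with disjoint interiors\<close>

lemma quad_neg_interior:
  assumes "quad v x < 0"
  shows "Some x \<in> ext_interior (lball v)"
proof -
  have "open {x. quad v x < 0}"
    unfolding quad_def by (intro open_Collect_less continuous_intros)
  then have "x \<in> interior {x. quad v x \<le> 0}"
    using assms by (intro interiorI[of "{x. quad v x < 0}"]) auto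
  moreover have "{x. Some x \<in> lball v} = {x. quad v x \<le> 0}"
    by (auto simp: lball_def)
  ultimately show ?thesis
    by (simp add: ext_interior_def)
qed

text \<open>Second-order expansion along a line: \<open>fst v *\<^sub>R p - fst (snd v)\<close> is
  half the gradient of \<open>quad v\<close> at \<open>p\<close>, so its sign against
  \<open>u\<close> decides whether a boundary point moves into the open ball.\<close>

lemma quad_along_line:
  "quad v (p + t *\<^sub>R u) =
     quad v p + t * (2 * ((fst v *\<^sub>R p - fst (snd v)) \<bullet> u) + t * (fst v * (u \<bullet> u)))"
  by (simp add: quad_def inner_add inner_diff inner_commute algebra_simps)

lemma quad_eventually_neg_near:
  assumes "quad v p \<le> 0" and "quad v p = 0 \<Longrightarrow> (fst v *\<^sub>R p - fst (snd v)) \<bullet> u < 0"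
  shows "\<forall>\<^sub>F t in at_right 0. quad v (p + t *\<^sub>R u) < 0"
proof (cases "quad v p = 0")
  case True
  let ?c = "(fst v *\<^sub>R p - fst (snd v)) \<bullet> u"
  have "((\<lambda>t. 2 * ?c + t * (fst v * (u \<bullet> u))) \<longlongrightarrow> 2 * ?c + 0 * (fst v * (u \<bullet> u))) (at_right 0)"
    by (intro tendsto_intros)
  then have "\<forall>\<^sub>F t in at_right 0. 2 * ?c + t * (fst v * (u \<bullet> u)) < 0"
    using assms(2)[OF True] by (auto dest: order_tendstoD(2)[where a = 0])
  moreover have "\<forall>\<^sub>F t in at_right 0. (t::real) > 0"
    by (simp add: eventually_at_right_less)
  ultimately show ?thesis
    by eventually_elim (simp add: quad_along_line True mult_pos_neg)
next
  case False
  have "((\<lambda>t. quad v (p + t *\<^sub>R u)) \<longlongrightarrow> quad v (p + 0 *\<^sub>R u)) (at_right 0)"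
    unfolding quad_def by (intro tendsto_intros)
  then show ?thesis
    using assms(1) False by (auto dest: order_tendstoD(2)[where a = 0])
qed

lemma quad_eventually_neg_far:
  assumes "fst v < 0 \<and> u \<noteq> 0 \<or> fst v = 0 \<and> fst (snd v) \<bullet> u > 0"
  shows "\<forall>\<^sub>F t in at_top. quad v (t *\<^sub>R u) < 0"
proof -
  let ?c = "fst (snd v) \<bullet> u"
  have eq: "quad v (t *\<^sub>R u) = t\<^sup>2 * (fst v * (u \<bullet> u)) - 2 * ?c * t + snd (snd v)" for t
    by (simp add: quad_def power2_eq_square algebra_simps)
  from assms show ?thesis
  proof
    assume "fst v < 0 \<and> u \<noteq> 0"
    then have neg: "fst v * (u \<bullet> u) < 0"
      by (simp add: mult_neg_pos)
    let ?a = "fst v * (u \<bullet> u)"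
    have "((\<lambda>t::real. ?a - 2 * ?c * inverse t + snd (snd v) * (inverse t)\<^sup>2) \<longlongrightarrow>
        ?a - 2 * ?c * 0 + snd (snd v) * 0\<^sup>2) at_top"
      by (intro tendsto_intros tendsto_inverse_0_at_top filterlim_ident)
    then have "\<forall>\<^sub>F t::real in at_top. ?a - 2 * ?c * inverse t + snd (snd v) * (inverse t)\<^sup>2 < 0"
      using neg by (intro order_tendstoD(2)) auto
    moreover have "\<forall>\<^sub>F t::real in at_top. t > 0"
      by (rule eventually_gt_at_top)
    ultimately show ?thesis
    proof eventually_elim
      case (elim t)
      have "quad v (t *\<^sub>R u) = t\<^sup>2 * (?a - 2 * ?c * inverse t + snd (snd v) * (inverse t)\<^sup>2)"
        using elim(2) by (simp add: eq field_simps power2_eq_square)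
      then show ?case
        using elim by (simp add: mult_pos_neg)
    qed
  next
    assume *: "fst v = 0 \<and> ?c > 0"
    have "\<forall>\<^sub>F t::real in at_top. t > snd (snd v) / (2 * ?c)"
      by (rule eventually_gt_at_top)
    then show ?thesis
      by eventually_elim (use * in \<open>simp add: eq field_simps\<close>)
  qed
qed

lemma unit_inner_gt:
  fixes n n' :: "'a::real_inner"
  assumes "n \<bullet> n = 1" "n' \<bullet> n' = 1" "n \<bullet> n' \<noteq> -1"
  shows "n \<bullet> n' > -1"
proof -
  have "(n + n') \<bullet> (n + n') \<ge> 0" by simp
  then show ?thesis
    using assms by (simp add: inner_add inner_commute)
qed

text \<open>With \<open>v = w\<close> of norm 1 the half-gradient is seen to be a unit vector, the
  outer normal at \<open>p\<close>. So \<open>lor\<close> is the cosine of the angle between the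
  normals at a common boundary point.\<close>

lemma quad_gradient_inner:
  assumes "quad v p = 0" "quad w p = 0"
  shows "(fst v *\<^sub>R p - fst (snd v)) \<bullet> (fst w *\<^sub>R p - fst (snd w)) = lor v w"
proof -
  have v: "fst (snd v) \<bullet> p = (fst v * (p \<bullet> p) + snd (snd v)) / 2"
    and w: "p \<bullet> fst (snd w) = (fst w * (p \<bullet> p) + snd (snd w)) / 2"
    using assms by (simp_all add: quad_def inner_commute)
  show ?thesis
    by (simp add: lor_def inner_diff v w field_simps)
qed

text \<open>If the product differs from \<open>-1\<close>, the two normals at the shared point are
  not opposite, and some direction leads from that point into both interiors at once. At infinity
  the same is done with a ray running off to infinity.\<close>

lemma lball_touching:
  fixes v w :: "real \<times> 'a::euclidean_space \<times> real"
  assumes v: "lor v v = 1" and w: "lor w w = 1"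
    and disj: "ext_interior (lball v) \<inter> ext_interior (lball w) = {}"
    and ne: "lball v \<inter> lball w \<noteq> {}"
  shows "lor v w = -1"
proof (rule ccontr)
  assume neq: "lor v w \<noteq> -1"
  have no: "\<not> (quad v x < 0 \<and> quad w x < 0)" for x
    using disj quad_neg_interior by blast
  obtain q where q: "q \<in> lball v" "q \<in> lball w"
    using ne by blast
  show False
  proof (cases q)
    case (Some p)
    let ?n = "fst v *\<^sub>R p - fst (snd v)" and ?n' = "fst w *\<^sub>R p - fst (snd w)"
    have le: "quad v p \<le> 0" "quad w p \<le> 0"
      using q Some by (auto simp: lball_def split: if_splits)
    have "\<exists>u. (quad v p = 0 \<longrightarrow> ?n \<bullet> u < 0) \<and> (quad w p = 0 \<longrightarrow> ?n' \<bullet> u < 0)"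
    proof -
      consider "quad v p = 0" "quad w p = 0" | "quad v p \<noteq> 0" | "quad w p \<noteq> 0"
        by blast
      then show ?thesis
      proof cases
        case 1
        have n: "?n \<bullet> ?n = 1" "?n' \<bullet> ?n' = 1" "?n \<bullet> ?n' = lor v w"
          using quad_gradient_inner[OF 1(1) 1(1)] quad_gradient_inner[OF 1(2) 1(2)]
            quad_gradient_inner[OF 1] v w by auto
        then have "?n \<bullet> ?n' > -1"
          using unit_inner_gt neq by metis
        \<comment> \<open>The inward bisector works for both balls, since each product equals
          \<open>-(1 + lor v w)\<close>, which is negative.\<close>
        then have "?n \<bullet> (- (?n + ?n')) < 0" "?n' \<bullet> (- (?n + ?n')) < 0"
          using n by (simp_all only: inner_minus_right inner_add_right inner_commute[of ?n' ?n])
        then show ?thesis by blast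
      next
        case 2
        have "?n' \<bullet> (- ?n') < 0" if "quad w p = 0"
          using quad_gradient_inner[OF that that] w by (simp only: inner_minus_right)
        then show ?thesis using 2 by blast
      next
        case 3
        have "?n \<bullet> (- ?n) < 0" if "quad v p = 0"
          using quad_gradient_inner[OF that that] v by (simp only: inner_minus_right)
        then show ?thesis using 3 by blast
      qed
    qed
    then obtain u where u: "quad v p = 0 \<Longrightarrow> ?n \<bullet> u < 0" "quad w p = 0 \<Longrightarrow> ?n' \<bullet> u < 0"
      by blast
    have "\<forall>\<^sub>F t in at_right 0. quad v (p + t *\<^sub>R u) < 0 \<and> quad w (p + t *\<^sub>R u) < 0"
      using quad_eventually_neg_near[OF le(1) u(1)] quad_eventually_neg_near[OF le(2) u(2)]
      by (rule eventually_conj)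
    then show False
      using no by simp
  next
    case None
    have le: "fst v \<le> 0" "fst w \<le> 0"
      using q None by (auto simp: lball_def split: if_splits)
    \<comment> \<open>For a half-space the first component is 0 and \<open>?m\<close> is its inward
      unit normal; the product of two half-spaces is \<open>?m \<bullet> ?m'\<close>. The exterior
      of a ball contains the far part of every ray in a nonzero direction.\<close>
    let ?m = "fst (snd v)" and ?m' = "fst (snd w)"
    have m: "fst v = 0 \<Longrightarrow> ?m \<bullet> ?m = 1" "fst w = 0 \<Longrightarrow> ?m' \<bullet> ?m' = 1"
      using v w by (simp_all add: lor_def)
    have "\<exists>u. (fst v < 0 \<and> u \<noteq> 0 \<or> fst v = 0 \<and> ?m \<bullet> u > 0) \<and>
              (fst w < 0 \<and> u \<noteq> 0 \<or> fst w = 0 \<and> ?m' \<bullet> u > 0)"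
    proof -
      consider "fst v = 0" "fst w = 0" | "fst v < 0" "fst w = 0" | "fst v = 0" "fst w < 0"
        | "fst v < 0" "fst w < 0"
        using le by linarith
      then show ?thesis
      proof cases
        case 1
        then have "?m \<bullet> ?m' > -1"
          using m neq by (intro unit_inner_gt) (auto simp: lor_def)
        then have "?m \<bullet> (?m + ?m') > 0" "?m' \<bullet> (?m + ?m') > 0"
          using m 1 by (simp_all add: inner_add_right inner_commute)
        then show ?thesis using 1 by blast
      next
        case 2
        then show ?thesis
          using m by (intro exI[of _ ?m']) auto
      next
        case 3
        then show ?thesis
          using m by (intro exI[of _ ?m]) auto
      next
        case 4
        obtain u :: 'a where "u \<in> Basis"
          using nonempty_Basis by blast
        then show ?thesis
          using 4 nonzero_Basis by blast
      qed
    qed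
    then obtain u where u: "fst v < 0 \<and> u \<noteq> 0 \<or> fst v = 0 \<and> ?m \<bullet> u > 0"
      "fst w < 0 \<and> u \<noteq> 0 \<or> fst w = 0 \<and> ?m' \<bullet> u > 0"
      by blast
    have "\<forall>\<^sub>F t in at_top. quad v (t *\<^sub>R u) < 0 \<and> quad w (t *\<^sub>R u) < 0"
      using quad_eventually_neg_far[OF u(1)] quad_eventually_neg_far[OF u(2)]
      by (rule eventually_conj)
    then have "\<exists>t. quad v (t *\<^sub>R u) < 0 \<and> quad w (t *\<^sub>R u) < 0"
      by (rule eventually_happens'[OF trivial_limit_at_top_linorder])
    then show False
      using no by blast
  qed
qed

lemma inj_on_lvec: "inj_on lvec {B. dball B}"
  by (rule inj_on_inverseI[of _ lball]) (simp add: lvec)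

lemma lor_lvec_tangent:
  assumes "ball_packing P" "A \<in> P" "B \<in> P" "A \<noteq> B" "tangent A B"
  shows "lor (lvec A) (lvec B) = -1"
proof -
  have "dball A" "dball B" and disj: "ext_interior A \<inter> ext_interior B = {}"
    using assms by (auto simp: ball_packing_def pairwise_def)
  moreover have "A \<inter> B \<noteq> {}"
    using assms(5) by (auto simp: tangent_def)
  ultimately show ?thesis
    using lball_touching[of "lvec A" "lvec B"] by (simp add: lvec)
qed

section \<open>The Gram matrix of pairwise tangent balls\<close>

definition unit_tangent :: "(real \<times> 'a::real_inner \<times> real) set \<Rightarrow> bool" where
  "unit_tangent V \<longleftrightarrow> (\<forall>x\<in>V. \<forall>y\<in>V. lor x y = (if x = y then 1 else -1))"

text \<open>The Gram matrix is \<open>2 I - J\<close> with \<open>J\<close> the all-ones matrix;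
  this is its action on a coefficient vector.\<close>

lemma lor_lincomb:
  assumes "unit_tangent V" "finite V" "x \<in> V"
  shows "lor x (\<Sum>v\<in>V. u v *\<^sub>R v) = 2 * u x - sum u V"
proof -
  have "lor x (\<Sum>v\<in>V. u v *\<^sub>R v) = (\<Sum>v\<in>V. u v * lor x v)"
    by (simp add: lor_sum_right lor_scaleR_right)
  also have "\<dots> = (\<Sum>v\<in>V. (if v = x then 2 * u x else 0) - u v)"
    using assms by (intro sum.cong) (auto simp: unit_tangent_def)
  also have "\<dots> = 2 * u x - sum u V"
    using assms by (simp add: sum_subtractf)
  finally show ?thesis .
qed

text \<open>A kernel vector of \<open>2 I - J\<close> has all coordinates equal to half their sum,
  so the sum vanishes unless there are exactly two coordinates.\<close>

lemma independent_unit_tangent: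
  fixes V :: "(real \<times> 'a::euclidean_space \<times> real) set"
  assumes "unit_tangent V" "finite V" "card V \<noteq> 2"
  shows "independent V"
proof -
  have "u x = 0" if "(\<Sum>v\<in>V. u v *\<^sub>R v) = 0" "x \<in> V" for u x
  proof -
    have eq: "u y = sum u V / 2" if "y \<in> V" for y
      using lor_lincomb[OF assms(1,2) that, of u] \<open>(\<Sum>v\<in>V. u v *\<^sub>R v) = 0\<close>
      by (simp add: lor_zero_right)
    have "sum u V = (\<Sum>y\<in>V. sum u V / 2)"
      using eq by (intro sum.cong refl)
    then have "sum u V * (real (card V) - 2) = 0"
      by (simp add: field_simps)
    then have "sum u V = 0"
      using assms(3) by simp
    then show ?thesis
      using eq[OF that(2)] by simp
  qed
  then show ?thesis
    using assms(2) by (auto simp: independent_explicit)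
qed

text \<open>The difference \<open>c - k\<close> is orthogonal to \<open>V\<close>, which leaves a
  line of candidates: in the basis \<open>insert k V\<close> its coefficients are one number
  \<open>g\<close> on \<open>V\<close> and \<open>-(d - 1) * g\<close> at \<open>k\<close>. The
  condition \<open>lor c c = 1\<close> is then a quadratic equation in \<open>g\<close> with roots
  \<open>0\<close> and \<open>2 / (d - 1)\<close>.\<close>

lemma unit_tangent_completion:
  fixes V :: "(real \<times> 'a::euclidean_space \<times> real) set"
  defines "d \<equiv> DIM('a)"
  assumes k: "unit_tangent (insert k V)" "k \<notin> V" and c: "unit_tangent (insert c V)" "c \<notin> V"
    and V: "finite V" "card V = d + 1" and d: "d \<ge> 2"
  shows "c = k \<or> c = (2 / (real d - 1)) *\<^sub>R \<Sum>V - k"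
proof -
  have fin: "finite (insert k V)" and card: "card (insert k V) = d + 2"
    using k(2) V by auto
  have "independent (insert k V)"
    using independent_unit_tangent[OF k(1) fin] card d by simp
  then have "span (insert k V) = UNIV"
    using card_eq_dim[of "insert k V" UNIV] card fin by (auto simp: d_def dim_UNIV)
  then obtain u where u: "c - k = (\<Sum>v\<in>insert k V. u v *\<^sub>R v)"
    using span_finite[OF fin] by blast
  define g where "g = sum u (insert k V) / 2"
  have ortho: "lor t (c - k) = 0" if "t \<in> V" for t
    using that k c by (auto simp: lor_diff_right unit_tangent_def)
  have ut: "u t = g" if "t \<in> V" for t
    using lor_lincomb[OF k(1) fin, of t u] ortho[OF that] that u by (simp add: g_def)
  have "2 * g = u k + sum u V"
    using k(2) V(1) by (simp add: g_def)
  also have "sum u V = (\<Sum>t\<in>V. g)"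
    by (intro sum.cong refl ut)
  finally have uk: "u k = - (real d - 1) * g"
    using V by (simp add: algebra_simps)
  have "(\<Sum>v\<in>V. u v *\<^sub>R v) = (\<Sum>v\<in>V. g *\<^sub>R v)"
    by (intro sum.cong refl) (simp add: ut)
  then have y: "c - k = u k *\<^sub>R k + g *\<^sub>R \<Sum>V"
    using u k(2) V(1) by (simp add: scaleR_sum_right)
  have ky: "lor k (c - k) = - 2 * real d * g"
    using lor_lincomb[OF k(1) fin, of k u] u uk by (simp add: g_def algebra_simps)
  have "lor (c - k) (\<Sum>V) = (\<Sum>t\<in>V. lor (c - k) t)"
    by (simp only: lor_sum_right)
  also have "\<dots> = 0"
    using ortho by (intro sum.neutral) (simp add: lor_commute)
  finally have yV: "lor (c - k) (\<Sum>V) = 0" .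
  have y1: "lor (c - k) (c - k) = lor (c - k) (u k *\<^sub>R k + g *\<^sub>R \<Sum>V)"
    using y by (rule arg_cong)
  have y2: "lor (c - k) (u k *\<^sub>R k + g *\<^sub>R \<Sum>V) = u k * lor k (c - k)"
    using lor_commute[of "c - k" k] yV
    by (simp only: lor_add_right lor_scaleR_right mult_zero_right add_0_right)
  have yy: "lor (c - k) (c - k) = 2 * real d * (real d - 1) * g\<^sup>2"
    unfolding trans[OF y1 y2] ky uk by algebra
  have "lor c c = lor k k + 2 * lor k (c - k) + lor (c - k) (c - k)"
    using lor_diff_right[of "c - k" c k] lor_diff_right[of c c k] lor_diff_right[of k c k]
      lor_commute[of "c - k" c] lor_commute[of "c - k" k] lor_commute[of c k]
    by linarith
  moreover have "lor c c = 1" "lor k k = 1"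
    using k(1) c(1) by (simp_all add: unit_tangent_def)
  ultimately have "- 4 * real d * g + 2 * real d * (real d - 1) * g\<^sup>2 = 0"
    unfolding ky yy by simp
  then have "g * ((real d - 1) * g - 2) * (2 * real d) = 0"
    by algebra
  then have "g = 0 \<or> (real d - 1) * g - 2 = 0"
    using d by simp
  then have "g = 0 \<or> g = 2 / (real d - 1)"
    using d by (auto simp: field_simps)
  then show ?thesis
  proof
    assume "g = 0"
    then show ?thesis using y uk by simp
  next
    assume g: "g = 2 / (real d - 1)"
    then have "(real d - 1) * g = 2"
      using d by (simp only: times_divide_eq_right nonzero_mult_div_cancel_left)
    then have "u k = -2"
      using uk by (simp only: mult_minus_left)
    then have "c - k = g *\<^sub>R \<Sum>V - 2 *\<^sub>R k"
      using y by simp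
    then have "c = g *\<^sub>R \<Sum>V - k"
      by (simp add: algebra_simps scaleR_2)
    then show ?thesis using g by simp
  qed
qed

section \<open>Walks through Descartes configurations\<close>

text \<open>\<open>clique_walk \<D> \<Delta> a \<Delta>' b\<close>: a non-backtracking walk from \<open>\<Delta>\<close> to \<open>\<Delta>'\<close> through members of \<open>\<D>\<close> that exchange
  one element at a time; the first exchange removes \<open>a\<close>, the last one inserts \<open>b\<close>.\<close>
inductive clique_walk :: "'b set set \<Rightarrow> 'b set \<Rightarrow> 'b \<Rightarrow> 'b set \<Rightarrow> 'b \<Rightarrow> bool" for \<D> where
  one: "\<lbrakk> \<Delta> \<in> \<D>; insert b (\<Delta> - {a}) \<in> \<D>; a \<in> \<Delta>; b \<notin> \<Delta> \<rbrakk>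
        \<Longrightarrow> clique_walk \<D> \<Delta> a (insert b (\<Delta> - {a})) b"
| more: "\<lbrakk> clique_walk \<D> \<Delta> a \<Delta>' b; insert c (\<Delta>' - {k}) \<in> \<D>; k \<in> \<Delta>'; k \<noteq> b; c \<notin> \<Delta>' \<rbrakk>
        \<Longrightarrow> clique_walk \<D> \<Delta> a (insert c (\<Delta>' - {k})) c"

lemma clique_walk_mono:
  assumes "clique_walk \<D> \<Delta> a \<Delta>' b" "\<D> \<subseteq> \<E>"
  shows "clique_walk \<E> \<Delta> a \<Delta>' b"
  using assms by (induction rule: clique_walk.induct) (auto intro: clique_walk.intros)

lemma clique_walk_members:
  assumes "clique_walk \<D> \<Delta> a \<Delta>' b"
  shows "\<Delta> \<in> \<D>" "\<Delta>' \<in> \<D>" "a \<in> \<Delta>" "b \<in> \<Delta>'"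
  using assms by (induction rule: clique_walk.induct) auto

text \<open>Together with its mirror image \<open>clique_walk_first_shared\<close> this keeps
  extended walks non-backtracking: if \<open>\<Delta>' - {C}\<close> lies in no other member, no
  walk ends by inserting \<open>C\<close>, so removing \<open>C\<close> next is allowed.\<close>

lemma clique_walk_last_shared:
  assumes "clique_walk \<D> \<Delta> a \<Delta>' b"
  shows "\<exists>\<Gamma>\<in>\<D>. \<Gamma> \<noteq> \<Delta>' \<and> \<Delta>' - {b} \<subseteq> \<Gamma>"
  using assms
proof cases
  case one
  then show ?thesis by (intro bexI[of _ \<Delta>]) auto
next
  case (more \<Delta>'' b' k)
  then show ?thesis
    using clique_walk_members[OF more(2)] by (intro bexI[of _ \<Delta>'']) auto
qed

lemma clique_walk_first_shared:
  assumes "clique_walk \<D> \<Delta> a \<Delta>' b"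
  shows "\<exists>\<Gamma>\<in>\<D>. \<Gamma> \<noteq> \<Delta> \<and> \<Delta> - {a} \<subseteq> \<Gamma>"
  using assms
proof (induction rule: clique_walk.induct)
  case (one \<Delta> b a)
  then show ?case by (intro bexI[of _ "insert b (\<Delta> - {a})"]) auto
qed auto

lemma clique_walk_prepend:
  assumes "clique_walk \<D> \<Delta> a \<Delta>' b" "a \<noteq> c" "c \<in> \<Delta>" "x \<notin> \<Delta>" "insert x (\<Delta> - {c}) \<in> \<D>"
  shows "clique_walk \<D> (insert x (\<Delta> - {c})) x \<Delta>' b"
  using assms
proof (induction rule: clique_walk.induct)
  case (one \<Delta> b a)
  have eq: "insert c (insert x (\<Delta> - {c}) - {x}) = \<Delta>"
    using one by auto
  have "clique_walk \<D> (insert x (\<Delta> - {c})) x \<Delta> c"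
    using clique_walk.one[of "insert x (\<Delta> - {c})" \<D> c x] one eq by auto
  then show ?case
    using one by (intro clique_walk.more) auto
qed (auto intro: clique_walk.more)

text \<open>Cut the walk at the last departure of \<open>x\<close>; the remainder begins with the
  exchange that removes \<open>x\<close>.\<close>

lemma clique_walk_suffix:
  assumes "clique_walk \<D> \<Delta> a \<Delta>' b" "x \<in> \<Delta>" "x \<notin> \<Delta>'"
  shows "\<exists>\<Gamma>. clique_walk \<D> \<Gamma> x \<Delta>' b"
  using assms
proof (induction rule: clique_walk.induct)
  case (one \<Delta> b a)
  then show ?case
    using clique_walk.one[OF one(1-4)] by auto
next
  case (more \<Delta> a \<Delta>' b c k)
  show ?case
  proof (cases "x \<in> \<Delta>'")
    case True
    then have "x = k" using more by auto
    then show ?thesis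
      using clique_walk.one[of \<Delta>' \<D> c k] more clique_walk_members[OF more(1)] by auto
  next
    case False
    then show ?thesis
      using more clique_walk.more by metis
  qed
qed

section \<open>Growth of denominators along a walk\<close>

text \<open>The \<open>p\<close>-adic heart of the argument: the value at the most recently inserted element
  has a denominator that grows with every exchange. The factor \<open>z\<close> is only needed for \<open>p = 2\<close>.\<close>

lemma clique_walk_denominator:
  fixes h :: "'b \<Rightarrow> real" and u w z p :: int
  assumes walk: "clique_walk \<D> \<Delta> a \<Delta>' b"
    and card: "\<And>\<Gamma>. \<Gamma> \<in> \<D> \<Longrightarrow> finite \<Gamma> \<and> real (card \<Gamma>) = 3 + 2 * of_int w / of_int u"
    and flip: "\<And>\<Gamma> k c. \<lbrakk> \<Gamma> \<in> \<D>; insert c (\<Gamma> - {k}) \<in> \<D>; k \<in> \<Gamma>; c \<notin> \<Gamma> \<rbrakk>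
        \<Longrightarrow> h c = of_int u / of_int w * sum h (\<Gamma> - {k}) - h k"
    and init: "h a = -1" "\<And>x. x \<in> \<Delta> \<Longrightarrow> x \<noteq> a \<Longrightarrow> h x = 1"
    and num: "u \<noteq> 0" "w \<noteq> 0" "z dvd w" "z dvd 3 * w + 2 * u"
      "w\<^sup>2 + 4 * u * w + 2 * u\<^sup>2 = z * n" "prime p" "\<not> p dvd n" "\<not> p dvd u" "p dvd w"
  shows "(h b = 3 + 2 * of_int u / of_int w \<and> (\<forall>x\<in>\<Delta>' - {b}. h x = 1)) \<or>
    (\<exists>t N. t \<ge> 2 \<and> \<not> p dvd N \<and> h b = of_int (z * N) / of_int w ^ t \<and>
       (\<forall>x\<in>\<Delta>' - {b}. \<exists>M::int. h x = of_int (z * M) / of_int w ^ (t - 1)))"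
  using walk init
proof (induction rule: clique_walk.induct)
  case (one \<Delta> b a)
  let ?r = "of_int u / of_int w :: real"
  have "sum h (\<Delta> - {a}) = (\<Sum>x\<in>\<Delta> - {a}. 1)"
    using one by (intro sum.cong) auto
  also have "\<dots> = real (card \<Delta>) - 1"
    using one card[of \<Delta>] by (cases "card \<Delta>") (auto simp: card_Diff_singleton)
  \<comment> \<open>With \<open>w / u = (d - 1) / 2\<close> this is the number \<open>d + 1\<close>
    of retained elements.\<close>
  finally have s: "sum h (\<Delta> - {a}) = 2 + 2 * of_int w / of_int u"
    using card[of \<Delta>] one by simp
  have "h b = ?r * (2 + 2 * of_int w / of_int u) - (- 1)"
    using flip[of \<Delta> b a] one(1-5) s by simp
  then have "h b = 3 + 2 * of_int u / of_int w"
    using num(1,2) by (simp add: distrib_left)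
  then show ?case
    using one by auto
next
  case (more \<Delta> a \<Delta>' b c k)
  let ?r = "of_int u / of_int w :: real"
  have mem: "\<Delta>' \<in> \<D>" "b \<in> \<Delta>'"
    using clique_walk_members[OF more(1)] by auto
  have fin: "finite \<Delta>'"
    using card mem by auto
  have hc: "h c = ?r * sum h (\<Delta>' - {k}) - h k"
    using flip more mem by simp
  have "sum h (\<Delta>' - {k}) = h b + sum h (\<Delta>' - {k} - {b})"
    using fin mem more by (intro sum.remove) auto
  then have hc: "h c = ?r * (h b + sum h (\<Delta>' - {k} - {b})) - h k"
    using hc by simp
  have new: "insert c (\<Delta>' - {k}) - {c} = \<Delta>' - {k}"
    using more by auto
  from more.IH[OF more.prems] show ?case
  proof
    \<comment> \<open>The value after one exchange is kept apart because its numerator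
      \<open>3 * w + 2 * u\<close> need not satisfy the invariant: for \<open>u = 1\<close>,
      \<open>w = 2 * m\<close>, \<open>z = 2\<close> it is \<open>z * (3 * m + 1)\<close>, and
      \<open>3 * m + 1\<close> may be even. The invariant therefore starts at the second exchange,
      with \<open>t = 2\<close> and \<open>N = n\<close>.\<close>
    assume *: "h b = 3 + 2 * of_int u / of_int w \<and> (\<forall>x\<in>\<Delta>' - {b}. h x = 1)"
    have "sum h (\<Delta>' - {k} - {b}) = (\<Sum>x\<in>\<Delta>' - {k} - {b}. 1)"
      using * by (intro sum.cong) auto
    also have "\<dots> = real (card (\<Delta>' - {k} - {b}))"
      by simp
    also have "card \<Delta>' = Suc (Suc (card (\<Delta>' - {k} - {b})))"
      using card_Suc_Diff1[of \<Delta>' k] card_Suc_Diff1[of "\<Delta>' - {k}" b] fin mem(2) more(3,4) by simp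
    then have "real (card (\<Delta>' - {k} - {b})) = real (card \<Delta>') - 2"
      by simp
    finally have s: "sum h (\<Delta>' - {k} - {b}) = 1 + 2 * of_int w / of_int u"
      using card[OF mem(1)] by simp
    have "h k = 1"
      using * more(3,4) by blast
    then have "h c = ?r * ((3 + 2 * ?r) + (1 + 2 * of_int w / of_int u)) - 1"
      using hc * s by simp
    then have "h c = 1 + 4 * ?r + 2 * ?r\<^sup>2"
      using num(1,2) by (simp add: distrib_left power2_eq_square ac_simps)
    also have "\<dots> = of_int (w\<^sup>2 + 4 * u * w + 2 * u\<^sup>2) / of_int w ^ 2"
      using num(2) by (simp add: field_simps power2_eq_square)
    finally have c: "h c = of_int (z * n) / of_int w ^ 2"
      by (simp only: num(5))
    have old: "\<exists>M::int. h x = of_int (z * M) / of_int w ^ (2 - 1)" if "x \<in> \<Delta>' - {k}" for x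
    proof (cases "x = b")
      case True
      obtain M where "3 * w + 2 * u = z * M"
        using num(3,4) by (auto elim: dvdE)
      moreover have "h b = of_int (3 * w + 2 * u) / of_int w"
        using * num(2) by (simp add: field_simps)
      ultimately show ?thesis
        using True by auto
    next
      case False
      obtain M where "w = z * M"
        using num(3,4) by (auto elim: dvdE)
      moreover have "h x = of_int w / of_int w"
        using * num(2) False that by simp
      ultimately show ?thesis
        by auto
    qed
    show ?thesis
      using c old num(7) by (intro disjI2 exI[of _ 2] exI[of _ n]) (auto simp: new)
  next
    assume "\<exists>t N. t \<ge> 2 \<and> \<not> p dvd N \<and> h b = of_int (z * N) / of_int w ^ t \<and>
       (\<forall>x\<in>\<Delta>' - {b}. \<exists>M::int. h x = of_int (z * M) / of_int w ^ (t - 1))"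
    then obtain t N M where t: "t \<ge> 2" and N: "\<not> p dvd N" "h b = of_int (z * N) / of_int w ^ t"
      and M: "\<And>x. x \<in> \<Delta>' - {b} \<Longrightarrow> h x = of_int (z * M x) / of_int w ^ (t - 1)"
      by metis
    obtain t' where t': "t = Suc t'"
      using t by (cases t) auto
    \<comment> \<open>Modulo \<open>p\<close> only \<open>u * N\<close> survives, because
      \<open>p\<close> divides \<open>w\<close>. This is where non-backtracking enters: as
      \<open>k \<noteq> b\<close>, the subtracted value has the smaller denominator and cannot
      cancel the contribution of \<open>b\<close>.\<close>
    define K where "K = u * N + w * (u * sum M (\<Delta>' - {k} - {b}) - w * M k)"
    have "sum h (\<Delta>' - {k} - {b}) = (\<Sum>x\<in>\<Delta>' - {k} - {b}. of_int (z * M x) / of_int w ^ t')"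
      using M t' by (intro sum.cong) auto
    then have s: "sum h (\<Delta>' - {k} - {b}) = of_int (z * sum M (\<Delta>' - {k} - {b})) / of_int w ^ t'"
      by (simp add: sum_distrib_left sum_divide_distrib)
    have hk: "h k = of_int (z * M k) / of_int w ^ t'"
      using M[of k] more t' by simp
    have "h c = of_int (z * K) / of_int w ^ Suc t"
      using num(2) by (simp add: hc s hk N(2) t' K_def field_simps)
    moreover have "\<not> p dvd K"
    proof
      assume "p dvd K"
      then have "p dvd u * N"
        using num(9) unfolding K_def by (subst (asm) dvd_add_left_iff) simp_all
      then show False
        using num N by (simp add: prime_dvd_mult_iff)
    qed
    moreover have "\<exists>M'::int. h x = of_int (z * M') / of_int w ^ (Suc t - 1)" if "x \<in> \<Delta>' - {k}" for x
    proof (cases "x = b")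
      case True
      then show ?thesis using N by auto
    next
      case False
      then have "h x = of_int (z * (M x * w)) / of_int w ^ (Suc t - 1)"
        using M[of x] that num(2) by (simp add: t')
      then show ?thesis by blast
    qed
    ultimately show ?thesis
      using t by (intro disjI2 exI[of _ "Suc t"] exI[of _ K]) (auto simp: new)
  qed
qed

text \<open>At most one factor 2 has to be stripped, and what remains is odd and larger than
  1.\<close>

lemma odd_prime_divisor:
  fixes q :: int
  assumes "q \<ge> 3" "\<not> 4 dvd q"
  shows "\<exists>p. prime p \<and> p dvd q \<and> \<not> p dvd 2"
proof -
  define r where "r = (if even q then q div 2 else q)"
  have r: "odd r" "r dvd q" "\<bar>r\<bar> \<noteq> 1"
    using assms by (auto simp: r_def elim!: evenE oddE)
  then obtain p where "prime p" "p dvd r"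
    using prime_factor_int[of r] by auto
  moreover have "\<not> p dvd 2"
    using calculation r(1) primes_dvd_imp_eq[of p 2] by auto
  ultimately show ?thesis
    using r dvd_trans by blast
qed

text \<open>A value 1 at level \<open>t\<close> would give \<open>z * N = w ^ t\<close> with
  \<open>p * z\<close> dividing the right-hand side, hence \<open>p\<close> would divide
  \<open>N\<close>. It remains to write \<open>2 / (d - 1)\<close> as \<open>u / w\<close> with
  suitable \<open>p\<close> and \<open>z\<close>.\<close>

lemma clique_walk_value_ne_1:
  fixes h :: "'b \<Rightarrow> real"
  assumes walk: "clique_walk \<D> \<Delta> a \<Delta>' b" and d: "d > 3"
    and card: "\<And>\<Gamma>. \<Gamma> \<in> \<D> \<Longrightarrow> card \<Gamma> = d + 2"
    and flip: "\<And>\<Gamma> k c. \<lbrakk> \<Gamma> \<in> \<D>; insert c (\<Gamma> - {k}) \<in> \<D>; k \<in> \<Gamma>; c \<notin> \<Gamma> \<rbrakk>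
        \<Longrightarrow> h c = 2 / (real d - 1) * sum h (\<Gamma> - {k}) - h k"
    and init: "h a = -1" "\<And>x. x \<in> \<Delta> \<Longrightarrow> x \<noteq> a \<Longrightarrow> h x = 1"
  shows "h b \<noteq> 1"
proof -
  have "\<exists>u w z n p :: int. 2 * w = (int d - 1) * u \<and> u > 0 \<and> w > 0 \<and> z \<noteq> 0 \<and> z dvd w \<and>
     z dvd 3 * w + 2 * u \<and> w\<^sup>2 + 4 * u * w + 2 * u\<^sup>2 = z * n \<and> prime p \<and>
     \<not> p dvd n \<and> \<not> p dvd u \<and> p dvd w \<and> p * z dvd w\<^sup>2"
  proof (cases "4 dvd int d - 1")
    case True
    \<comment> \<open>Here \<open>d - 1\<close> may be a power of 2, so \<open>p = 2\<close> and the
      coefficient is \<open>1 / (2 * m)\<close>. The expression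
      \<open>w\<^sup>2 + 4 * u * w + 2 * u\<^sup>2\<close> is even but not divisible by 4;
      \<open>z = 2\<close> splits off that factor and leaves an odd \<open>n\<close>.\<close>
    then obtain m where m: "int d - 1 = 4 * m" by auto
    then have "m > 0" using d by auto
    have "(2 * m)\<^sup>2 + 4 * 1 * (2 * m) + 2 * 1\<^sup>2 = 2 * (2 * m\<^sup>2 + 4 * m + 1)"
      by (simp add: power2_eq_square algebra_simps)
    moreover have "3 * (2 * m) + 2 * 1 = 2 * (3 * m + 1)"
      by simp
    ultimately show ?thesis
      using m \<open>m > 0\<close>
      by (intro exI[of _ 1] exI[of _ "2 * m"] exI[of _ 2] exI[of _ "2 * m\<^sup>2 + 4 * m + 1"] exI[of _ 2])
        (simp add: power_mult_distrib)
  next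
    case False
    then obtain p where p: "prime p" "p dvd int d - 1" "\<not> p dvd 2"
      using odd_prime_divisor[of "int d - 1"] d by auto
    \<comment> \<open>The fraction \<open>2 / ?w\<close> may stay unreduced since \<open>p\<close>
      is odd. Modulo \<open>p\<close> the number \<open>n\<close> is 8, so \<open>z = 1\<close>
      suffices.\<close>
    let ?w = "int d - 1"
    have "\<not> p dvd ?w\<^sup>2 + 4 * 2 * ?w + 2 * 2\<^sup>2"
    proof
      assume "p dvd ?w\<^sup>2 + 4 * 2 * ?w + 2 * 2\<^sup>2"
      moreover have "p dvd ?w\<^sup>2 + 4 * 2 * ?w"
        using p(2) by (intro dvd_add) (auto simp: power2_eq_square simp del: right_diff_distrib_numeral)
      ultimately have "p dvd 2 * 2\<^sup>2"
        using dvd_add_right_iff by blast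
      then have "p dvd 2 ^ 3"
        by (simp add: eval_nat_numeral)
      then show False
        using p prime_dvd_power by blast
    qed
    then show ?thesis
      using p d
      by (intro exI[of _ 2] exI[of _ ?w] exI[of _ 1] exI[of _ "?w\<^sup>2 + 4 * 2 * ?w + 2 * 2\<^sup>2"] exI[of _ p])
        (simp add: power2_eq_square)
  qed
  then obtain u w z n p :: int where uw: "2 * w = (int d - 1) * u" and pos: "u > 0" "w > 0" "z \<noteq> 0"
    and num: "z dvd w" "z dvd 3 * w + 2 * u" "w\<^sup>2 + 4 * u * w + 2 * u\<^sup>2 = z * n" "prime p"
      "\<not> p dvd n" "\<not> p dvd u" "p dvd w" and pz: "p * z dvd w\<^sup>2"
    by blast
  have "2 * real_of_int w = (real d - 1) * of_int u"
    using arg_cong[OF uw, of real_of_int] by simp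
  then have r: "2 / (real d - 1) = of_int u / of_int w" and c: "real d + 2 = 3 + 2 * of_int w / of_int u"
    using pos d by (simp_all add: field_simps)
  have fin: "finite \<Gamma> \<and> real (card \<Gamma>) = 3 + 2 * of_int w / of_int u" if "\<Gamma> \<in> \<D>" for \<Gamma>
    using card[OF that] c card_ge_0_finite[of \<Gamma>] by simp
  have "u \<noteq> 0" "w \<noteq> 0"
    using pos by auto
  from clique_walk_denominator[OF walk fin flip[unfolded r] init this num]
  consider "h b = 3 + 2 * of_int u / of_int w"
    | t N where "t \<ge> 2" "\<not> p dvd N" "h b = of_int (z * N) / of_int w ^ t"
    by blast
  then show ?thesis
  proof cases
    case 1
    have "of_int u / of_int w > (0::real)"
      using pos by simp
    then show ?thesis using 1 by simp
  next
    case 2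
    show ?thesis
    proof
      assume "h b = 1"
      then have "real_of_int (z * N) = of_int (w ^ t)"
        using 2 pos by simp
      then have "z * N = w ^ t"
        by linarith
      moreover have "p * z dvd w ^ t"
        using pz le_imp_power_dvd[OF 2(1), of w] dvd_trans by blast
      ultimately have "z * p dvd z * N"
        by (simp add: mult.commute)
      then show False
        using 2 pos by simp
    qed
  qed
qed

section \<open>The tree of Descartes configurations\<close>

lemma tangent_commute: "tangent A B \<longleftrightarrow> tangent B A"
  by (simp add: tangent_def Int_commute)

lemma ball_packing_subset: "ball_packing P \<Longrightarrow> Q \<subseteq> P \<Longrightarrow> ball_packing Q"
  unfolding ball_packing_def by (meson pairwise_subset subsetD)

lemma unit_tangent_lvec:
  assumes "ball_packing P" "\<Delta> \<subseteq> P" "pairwise tangent \<Delta>"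
  shows "unit_tangent (lvec ` \<Delta>)"
proof -
  have "lor (lvec A) (lvec B) = (if lvec A = lvec B then 1 else - 1)" if "A \<in> \<Delta>" "B \<in> \<Delta>" for A B
  proof (cases "A = B")
    case True
    have "dball A"
      using assms that by (auto simp: ball_packing_def)
    then show ?thesis
      using True lvec by simp
  next
    case False
    then have "lor (lvec A) (lvec B) = -1"
      using lor_lvec_tangent[OF assms(1)] assms that unfolding pairwise_def by blast
    moreover have "lor (lvec A) (lvec A) = 1"
      using assms that by (intro lvec) (auto simp: ball_packing_def)
    ultimately show ?thesis
      by auto
  qed
  then show ?thesis
    by (auto simp: unit_tangent_def)
qed

text \<open>Injectivity of \<open>lvec\<close> turns \<open>C \<noteq> K\<close> into distinct
  vectors, which excludes the trivial root of the completion equation.\<close>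

lemma tangent_ball_exchange:
  fixes P :: "(real^'n) option set set"
  assumes P: "ball_packing P" "insert K T \<subseteq> P" "insert C T \<subseteq> P"
    and K: "pairwise tangent (insert K T)" "K \<notin> T" and C: "pairwise tangent (insert C T)" "C \<notin> T"
    and T: "card T = CARD('n) + 1" and d: "CARD('n) \<ge> 2" and "C \<noteq> K"
  shows "lvec C = (2 / (real CARD('n) - 1)) *\<^sub>R (\<Sum>X\<in>T. lvec X) - lvec K"
proof -
  have "finite T"
    using T card_ge_0_finite[of T] by simp
  have inj: "inj_on lvec P"
    using P(1) by (intro inj_on_subset[OF inj_on_lvec]) (auto simp: ball_packing_def)
  then have injT: "inj_on lvec T"
    using P(2) by (meson inj_on_subset insert_subset)
  have notin: "lvec K \<notin> lvec ` T" "lvec C \<notin> lvec ` T" "lvec C \<noteq> lvec K"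
    using inj P(2,3) K(2) C(2) \<open>C \<noteq> K\<close> by (auto simp: inj_on_def)
  have "lvec C = lvec K \<or>
      lvec C = (2 / (real DIM(real^'n) - 1)) *\<^sub>R \<Sum>(lvec ` T) - lvec K"
    using unit_tangent_lvec[OF P(1,2) K(1)] unit_tangent_lvec[OF P(1,3) C(1)] notin
      \<open>finite T\<close> T d card_image[OF injT]
    by (intro unit_tangent_completion) auto
  then show ?thesis
    using notin sum.reindex[OF injT, of "\<lambda>x. x"] by simp
qed

text \<open>The combinatorial skeleton of an Apollonian packing: its Descartes configurations, any two of
  which are joined by a non-backtracking walk.\<close>
definition clique_tree :: "(real^'n) option set set \<Rightarrow> (real^'n) option set set set \<Rightarrow> bool" where
  "clique_tree S \<D> \<longleftrightarrow> \<Union>\<D> = S \<and>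
     (\<forall>\<Delta>\<in>\<D>. card \<Delta> = CARD('n) + 2 \<and> pairwise tangent \<Delta>) \<and>
     (\<forall>T\<subseteq>S. card T = CARD('n) + 1 \<longrightarrow> pairwise tangent T \<longrightarrow> (\<exists>\<Delta>\<in>\<D>. T \<subseteq> \<Delta>)) \<and>
     (\<forall>\<Delta>\<in>\<D>. \<forall>\<Delta>'\<in>\<D>. \<Delta> \<noteq> \<Delta>' \<longrightarrow> (\<exists>a b. clique_walk \<D> \<Delta> a \<Delta>' b))"

text \<open>The first two conclusions are what stacking needs: \<open>T\<close> is free to be
  stacked on, and the new ball has no neighbours besides \<open>T\<close>. The third restores the
  invariant; the new configuration is attached to the unique old one containing \<open>T\<close>,
  like a leaf to a tree.\<close>

lemma clique_tree_insert:
  fixes S :: "(real^'n) option set set"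
  assumes d: "CARD('n) > 3" and tree: "clique_tree S \<D>" and pack: "ball_packing (insert B S)"
    and B: "B \<notin> S" and T: "T \<subseteq> S" "card T = CARD('n) + 1" "pairwise tangent T"
    and TB: "\<forall>A\<in>T. tangent A B"
  shows "\<exists>!\<Delta>. \<Delta> \<in> \<D> \<and> T \<subseteq> \<Delta>"
    and "\<And>A. A \<in> S \<Longrightarrow> tangent A B \<longleftrightarrow> A \<in> T"
    and "clique_tree (insert B S) (insert (insert B T) \<D>)"
proof -
  let ?\<Delta> = "insert B T" and ?\<D> = "insert (insert B T) \<D>"
  have union: "\<Union>\<D> = S" and clique: "\<And>\<Delta>. \<Delta> \<in> \<D> \<Longrightarrow> card \<Delta> = CARD('n) + 2 \<and> pairwise tangent \<Delta>"
    and cover: "\<And>T. \<lbrakk> T \<subseteq> S; card T = CARD('n) + 1; pairwise tangent T \<rbrakk> \<Longrightarrow> \<exists>\<Delta>\<in>\<D>. T \<subseteq> \<Delta>"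
    and walks: "\<And>\<Delta> \<Delta>'. \<lbrakk> \<Delta> \<in> \<D>; \<Delta>' \<in> \<D>; \<Delta> \<noteq> \<Delta>' \<rbrakk> \<Longrightarrow> \<exists>a b. clique_walk \<D> \<Delta> a \<Delta>' b"
    using tree by (auto simp: clique_tree_def)
  have finT: "finite T"
    using T(2) card_ge_0_finite[of T] by simp
  have BT: "B \<notin> T"
    using B T by blast
  have new: "card ?\<Delta> = CARD('n) + 2" "pairwise tangent ?\<Delta>"
    using T TB BT finT by (auto simp: pairwise_insert tangent_commute)
  have split: "\<exists>C. \<Delta> = insert C T \<and> C \<notin> T \<and> C \<in> S" if "\<Delta> \<in> \<D>" "T \<subseteq> \<Delta>" for \<Delta>
  proof -
    have "card (\<Delta> - T) = 1"
      using card_Diff_subset[OF finT that(2)] clique[OF that(1)] T(2) by simp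
    then obtain C where "\<Delta> - T = {C}"
      by (auto simp: card_1_singleton_iff)
    then show ?thesis
      using that union by (intro exI[of _ C]) auto
  qed
  obtain \<Delta> where \<Delta>: "\<Delta> \<in> \<D>" "T \<subseteq> \<Delta>"
    using cover[OF T] by blast
  obtain C where C: "\<Delta> = insert C T" "C \<notin> T" "C \<in> S"
    using split[OF \<Delta>] by blast
  have unique: "\<Delta>' = \<Delta>" if \<Delta>': "\<Delta>' \<in> \<D>" "T \<subseteq> \<Delta>'" for \<Delta>'
  proof (rule ccontr)
    assume neq: "\<Delta>' \<noteq> \<Delta>"
    obtain C' where C': "\<Delta>' = insert C' T" "C' \<notin> T" "C' \<in> S"
      using split[OF \<Delta>'] by blast
    \<comment> \<open>Applied to \<open>B\<close> and to \<open>C'\<close>, this gives both the same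
      vector, so \<open>B = C'\<close>, although \<open>B\<close> is new.\<close>
    have *: "lvec X = (2 / (real CARD('n) - 1)) *\<^sub>R (\<Sum>X\<in>T. lvec X) - lvec C"
      if "X \<noteq> C" "X \<notin> T" "X \<in> insert B S" "pairwise tangent (insert X T)" for X
    proof (rule tangent_ball_exchange[OF pack])
      show "insert C T \<subseteq> insert B S" "insert X T \<subseteq> insert B S"
        using C T that by blast+
      show "pairwise tangent (insert C T)"
        using clique[OF \<Delta>(1)] C(1) by simp
    qed (use that C T d in simp_all)
    have "B \<noteq> C" "C' \<noteq> C" "pairwise tangent (insert C' T)"
      using B C C' neq clique[OF \<Delta>'(1)] by blast+
    then have "lvec B = lvec C'"
      using *[of B] *[of C'] BT C' new(2) by simp
    moreover have "dball B" "dball C'"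
      using pack C' by (auto simp: ball_packing_def)
    ultimately have "B = C'"
      using inj_on_lvec by (auto simp: inj_on_def)
    then show False
      using B C' by blast
  qed
  then show unique': "\<exists>!\<Delta>. \<Delta> \<in> \<D> \<and> T \<subseteq> \<Delta>"
    using \<Delta> by blast
  have \<Delta>C: "\<Delta> - {C} = T" and B\<Delta>: "B \<notin> \<Delta>" and C\<Delta>: "C \<in> \<Delta>"
    using C B BT by auto
  have exch: "insert B (\<Delta> - {C}) = ?\<Delta>"
    by (simp add: \<Delta>C)
  \<comment> \<open>A walk to \<open>\<Delta>\<close> is prolonged by exchanging \<open>C\<close>
    for \<open>B\<close>. This does not backtrack: had the walk just inserted \<open>C\<close>, then
    \<open>\<Delta> - {C} = T\<close> would lie in a second member.\<close>
  have walk_to: "\<exists>a. clique_walk ?\<D> \<Gamma> a ?\<Delta> B" if \<Gamma>: "\<Gamma> \<in> \<D>" for \<Gamma>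
  proof (cases "\<Gamma> = \<Delta>")
    case True
    then show ?thesis
      using clique_walk.one[of \<Delta> ?\<D> B C] \<Delta> C\<Delta> B\<Delta> exch by auto
  next
    case False
    then obtain a b where w: "clique_walk \<D> \<Gamma> a \<Delta> b"
      using walks \<Gamma> \<Delta> by blast
    have "b \<noteq> C"
      using clique_walk_last_shared[OF w] unique \<Delta>C by auto
    then show ?thesis
      using clique_walk.more[of ?\<D> \<Gamma> a \<Delta> b B C] clique_walk_mono[OF w, of ?\<D>] C\<Delta> B\<Delta> exch by auto
  qed
  have walk_from: "\<exists>a b. clique_walk ?\<D> ?\<Delta> a \<Gamma> b" if \<Gamma>: "\<Gamma> \<in> \<D>" for \<Gamma>
  proof (cases "\<Gamma> = \<Delta>")
    case True
    have "insert C (?\<Delta> - {B}) = \<Delta>"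
      using C BT by auto
    then show ?thesis
      using clique_walk.one[of ?\<Delta> ?\<D> C B] \<Delta> C B True by auto
  next
    case False
    then obtain a b where w: "clique_walk \<D> \<Delta> a \<Gamma> b"
      using walks \<Gamma> \<Delta> by blast
    have "a \<noteq> C"
      using clique_walk_first_shared[OF w] unique \<Delta>C by auto
    then have "clique_walk ?\<D> (insert B (\<Delta> - {C})) B \<Gamma> b"
      by (rule clique_walk_prepend[OF clique_walk_mono[OF w subset_insertI] _ C\<Delta> B\<Delta>]) (simp add: exch)
    then show ?thesis
      unfolding exch by blast
  qed
  have clique': "card \<Gamma> = CARD('n) + 2 \<and> pairwise tangent \<Gamma> \<and> \<Gamma> \<subseteq> insert B S" if "\<Gamma> \<in> ?\<D>" for \<Gamma>
    using that clique union new T by auto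
  show nbrs: "tangent A B \<longleftrightarrow> A \<in> T" if A: "A \<in> S" for A
  proof
    assume "tangent A B"
    show "A \<in> T"
    proof (rule ccontr)
      assume "A \<notin> T"
      obtain \<Gamma> where "\<Gamma> \<in> \<D>" "A \<in> \<Gamma>"
        using A union by blast
      moreover have "A \<notin> ?\<Delta>"
        using \<open>A \<notin> T\<close> A B by auto
      ultimately obtain \<Gamma>' where w: "clique_walk ?\<D> \<Gamma>' A ?\<Delta> B"
        using walk_to clique_walk_suffix by metis
      have \<Gamma>': "\<Gamma>' \<in> ?\<D>" "A \<in> \<Gamma>'"
        using clique_walk_members[OF w] by auto
      \<comment> \<open>The sign makes tangent balls have value 1, while \<open>h A = -1\<close>
        because \<open>lvec A\<close> has norm 1.\<close>
      define h where "h X = - lor (lvec A) (lvec X)" for X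
      have "h B \<noteq> 1"
      proof (rule clique_walk_value_ne_1[OF w d])
        show "card \<Gamma> = CARD('n) + 2" if "\<Gamma> \<in> ?\<D>" for \<Gamma>
          using clique' that by blast
        show "h A = - 1"
          using pack A by (simp add: h_def ball_packing_def lvec)
        show "h X = 1" if "X \<in> \<Gamma>'" "X \<noteq> A" for X
        proof -
          have "tangent A X" "X \<in> insert B S"
            using pairwiseD[of tangent \<Gamma>' A X] that \<Gamma>' clique'[OF \<Gamma>'(1)] by blast+
          then show ?thesis
            using lor_lvec_tangent[OF pack, of A X] A that by (simp add: h_def)
        qed
        show "h X = 2 / (real CARD('n) - 1) * sum h (\<Gamma> - {K}) - h K"
          if *: "\<Gamma> \<in> ?\<D>" "insert X (\<Gamma> - {K}) \<in> ?\<D>" "K \<in> \<Gamma>" "X \<notin> \<Gamma>" for \<Gamma> K X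
        proof -
          have "insert K (\<Gamma> - {K}) = \<Gamma>"
            using * by auto
          moreover have "card (\<Gamma> - {K}) = CARD('n) + 1"
            using * clique'[OF *(1)] by simp
          ultimately have "lvec X = (2 / (real CARD('n) - 1)) *\<^sub>R (\<Sum>X\<in>\<Gamma> - {K}. lvec X) - lvec K"
            using tangent_ball_exchange[OF pack, of K "\<Gamma> - {K}" X] clique'[OF *(1)] clique'[OF *(2)] * d
            by auto
          then show ?thesis
            by (simp add: h_def lor_diff_right lor_scaleR_right lor_sum_right sum_negf)
        qed
      qed
      moreover have "A \<noteq> B"
        using A B by blast
      ultimately show False
        using lor_lvec_tangent[OF pack, of A B] A \<open>tangent A B\<close> by (simp add: h_def)
    qed
  qed (use TB in blast)
  have "\<exists>\<Gamma>\<in>?\<D>. U \<subseteq> \<Gamma>"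
    if U: "U \<subseteq> insert B S" "card U = CARD('n) + 1" "pairwise tangent U" for U
  proof (cases "B \<in> U")
    case True
    \<comment> \<open>A clique through \<open>B\<close> consists of \<open>B\<close> and neighbours
      of \<open>B\<close>, and these are exactly \<open>T\<close>.\<close>
    then have "U \<subseteq> ?\<Delta>"
      using U nbrs by (auto simp: pairwise_def)
    then show ?thesis by blast
  next
    case False
    then show ?thesis
      using cover[of U] U by blast
  qed
  moreover have "\<exists>a b. clique_walk ?\<D> \<Gamma> a \<Gamma>' b" if \<Gamma>\<Gamma>: "\<Gamma> \<in> ?\<D>" "\<Gamma>' \<in> ?\<D>" "\<Gamma> \<noteq> \<Gamma>'" for \<Gamma> \<Gamma>'
  proof -
    consider "\<Gamma> \<in> \<D>" "\<Gamma>' \<in> \<D>" | "\<Gamma> = ?\<Delta>" "\<Gamma>' \<in> \<D>" | "\<Gamma> \<in> \<D>" "\<Gamma>' = ?\<Delta>"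
      using \<Gamma>\<Gamma> by blast
    then show ?thesis
    proof cases
      case 1
      obtain a b where "clique_walk \<D> \<Gamma> a \<Gamma>' b"
        using walks[OF 1 \<Gamma>\<Gamma>(3)] by blast
      then have "clique_walk ?\<D> \<Gamma> a \<Gamma>' b"
        by (rule clique_walk_mono[OF _ subset_insertI])
      then show ?thesis
        by blast
    next
      case 2
      then show ?thesis
        using walk_from by simp
    next
      case 3
      then show ?thesis
        using walk_to[of \<Gamma>] by blast
    qed
  qed
  moreover have "\<Union>?\<D> = insert B S"
    using union T by auto
  ultimately show "clique_tree (insert B S) ?\<D>"
    using clique' by (simp add: clique_tree_def)
qed

section \<open>Stacking a vertex onto a facet\<close>

lemma mem_convex_hull_insert_convex:
  assumes "convex P" "P \<noteq> {}" "x \<in> convex hull (insert v P)"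
  obtains t p where "0 \<le> t" "t \<le> 1" "p \<in> P" "x = (1 - t) *\<^sub>R p + t *\<^sub>R v"
proof -
  obtain u w p where "0 \<le> u" "0 \<le> w" "u + w = 1" "p \<in> P" "x = u *\<^sub>R v + w *\<^sub>R p"
    using assms(3) convex_hull_insert[OF assms(2)] hull_same[of convex P] assms(1) by auto
  then show ?thesis
    using that[of u p] by (simp add: add.commute eq_diff_eq)
qed

text \<open>A point of the new hull that uses \<open>v\<close> with positive weight lies strictly
  below the supporting hyperplane of \<open>E\<close>, so that hyperplane still cuts out
  \<open>E\<close>.\<close>

lemma face_of_insert_point_beneath:
  assumes P: "convex P" "P \<noteq> {}" and E: "E = P \<inter> {x. a \<bullet> x = b}" "P \<subseteq> {x. a \<bullet> x \<le> b}"
    and v: "a \<bullet> v < b"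
  shows "E face_of (convex hull (insert v P))"
proof -
  have sub: "convex hull (insert v P) \<subseteq> {x. a \<bullet> x \<le> b}"
    using E v by (intro hull_minimal convex_halfspace_le) auto
  have "convex hull (insert v P) \<inter> {x. a \<bullet> x = b} = E"
  proof (intro equalityI subsetI)
    fix x assume x: "x \<in> convex hull (insert v P) \<inter> {x. a \<bullet> x = b}"
    then obtain t p where t: "0 \<le> t" "t \<le> 1" "p \<in> P" "x = (1 - t) *\<^sub>R p + t *\<^sub>R v"
      using mem_convex_hull_insert_convex[OF P] by blast
    have "a \<bullet> x = (1 - t) * (a \<bullet> p) + t * (a \<bullet> v)"
      by (simp add: t inner_add_right)
    moreover have "(1 - t) * (a \<bullet> p) \<le> (1 - t) * b"
      using t E by (intro mult_left_mono) auto
    moreover have "t * (a \<bullet> v) < t * b" if "t \<noteq> 0"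
      using v t that by simp
    ultimately have "t = 0"
      using x by (cases "t = 0") (auto simp: algebra_simps)
    then show "x \<in> E"
      using x t E by simp
  next
    fix x assume "x \<in> E"
    then show "x \<in> convex hull (insert v P) \<inter> {x. a \<bullet> x = b}"
      using E hull_subset[of "insert v P" convex] by auto
  qed
  moreover have "(convex hull (insert v P) \<inter> {x. a \<bullet> x = b}) face_of convex hull (insert v P)"
    using sub by (intro face_of_Int_supporting_hyperplane_le) auto
  ultimately show ?thesis
    by simp
qed

text \<open>The supporting hyperplane is the member through \<open>v\<close> of the pencil spanned by the
  hyperplanes of \<open>E\<close> and of \<open>F\<close>.\<close>
lemma face_of_cone_over_subface:
  assumes P: "convex P" "P \<noteq> {}" and E: "E = P \<inter> {x. a \<bullet> x = b}" "P \<subseteq> {x. a \<bullet> x \<le> b}"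
    and F: "F = P \<inter> {x. c \<bullet> x = e}" "P \<subseteq> {x. c \<bullet> x \<le> e}"
    and v: "a \<bullet> v < b" "c \<bullet> v > e" and EF: "E \<subseteq> F"
  shows "(convex hull (insert v E)) face_of (convex hull (insert v P))"
proof -
  define s where "s = b - a \<bullet> v"
  define r where "r = c \<bullet> v - e"
  define n where "n = s *\<^sub>R c + r *\<^sub>R a"
  define k where "k = s * e + r * b"
  have sr: "s > 0" "r > 0"
    using v by (auto simp: s_def r_def)
  have nv: "n \<bullet> v = k"
    by (simp add: n_def k_def s_def r_def inner_add_left algebra_simps)
  have nP: "n \<bullet> x \<le> k \<and> (n \<bullet> x = k \<longrightarrow> x \<in> E)" if "x \<in> P" for x
  proof -
    have le: "s * (c \<bullet> x) \<le> s * e" "r * (a \<bullet> x) \<le> r * b"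
      using that E(2) F(2) sr by auto
    have eq: "n \<bullet> x = s * (c \<bullet> x) + r * (a \<bullet> x)"
      by (simp add: n_def inner_add_left)
    have "x \<in> E" if "n \<bullet> x = k"
    proof -
      have "r * (a \<bullet> x) = r * b"
        using le eq that unfolding k_def by linarith
      then show ?thesis
        using sr E \<open>x \<in> P\<close> by simp
    qed
    then show ?thesis
      using le eq by (auto simp: k_def)
  qed
  have nE: "n \<bullet> x = k" if "x \<in> E" for x
    using that EF E(1) F(1) by (auto simp: n_def k_def inner_add_left)
  have convE: "convex E"
    unfolding E(1) by (intro convex_Int P convex_hyperplane)
  have "convex hull (insert v P) \<inter> {x. n \<bullet> x = k} = convex hull (insert v E)"
  proof (intro equalityI subsetI)
    fix x assume x: "x \<in> convex hull (insert v P) \<inter> {x. n \<bullet> x = k}"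
    then obtain t p where t: "0 \<le> t" "t \<le> 1" "p \<in> P" "x = (1 - t) *\<^sub>R p + t *\<^sub>R v"
      using mem_convex_hull_insert_convex[OF P] by blast
    have "(1 - t) * (n \<bullet> p) = (1 - t) * k"
      using x nv by (simp add: t(4) inner_add_right algebra_simps)
    then have "t = 1 \<or> p \<in> E"
      using nP[OF t(3)] by auto
    then show "x \<in> convex hull (insert v E)"
    proof
      assume "t = 1"
      then show ?thesis
        using t by (simp add: hull_inc)
    next
      assume "p \<in> E"
      then show ?thesis
        unfolding t(4) using t
        by (intro convexD[OF convex_convex_hull]) (auto intro: hull_inc)
    qed
  next
    fix x assume "x \<in> convex hull (insert v E)"
    moreover have "convex hull (insert v E) \<subseteq> {x. n \<bullet> x = k}"
      using nE nv by (intro hull_minimal convex_hyperplane) auto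
    moreover have "convex hull (insert v E) \<subseteq> convex hull (insert v P)"
      using E by (intro hull_mono) auto
    ultimately show "x \<in> convex hull (insert v P) \<inter> {x. n \<bullet> x = k}"
      by auto
  qed
  moreover have "convex hull (insert v P) \<subseteq> {x. n \<bullet> x \<le> k}"
    using nP nv by (intro hull_minimal convex_halfspace_le) auto
  then have "(convex hull (insert v P) \<inter> {x. n \<bullet> x = k}) face_of convex hull (insert v P)"
    by (intro face_of_Int_supporting_hyperplane_le) auto
  ultimately show ?thesis
    by simp
qed

text \<open>Dimension drops strictly between nested distinct faces, and a facet leaves no room for
  an intermediate dimension.\<close>

lemma face_containing_facet:
  fixes P :: "'a::euclidean_space set"
  assumes "convex P" "F facet_of P" "E face_of P" "F \<subseteq> E"
  shows "E = F \<or> E = P"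
proof (rule ccontr)
  assume neg: "\<not> ?thesis"
  have "convex E"
    using assms(3) by (rule face_of_imp_convex)
  moreover have "F face_of E"
    using assms by (meson face_of_imp_subset face_of_subset facet_of_imp_face_of)
  ultimately have "aff_dim F < aff_dim E"
    using neg face_of_aff_dim_lt by blast
  moreover have "aff_dim E < aff_dim P"
    using assms neg face_of_aff_dim_lt by blast
  ultimately show False
    using assms(2) by (simp add: facet_of_def)
qed

text \<open>The apex \<open>v\<close> lies just outside \<open>F\<close>, close to a relative interior point of \<open>F\<close>.\<close>
lemma stacking_point_exists:
  fixes P :: "'a::euclidean_space set"
  assumes P: "polytope P" "aff_dim P = DIM('a)" and F: "F facet_of P" and dim: "DIM('a) \<ge> 2"
  obtains v where "beyond_facet v F P"
    and "\<And>G. G facet_of P \<Longrightarrow> G \<noteq> F \<Longrightarrow> beneath_facet v G P"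
    and "v \<notin> affine hull F" "v \<notin> P"
    and "\<And>E. E face_of P \<Longrightarrow> E \<noteq> P \<Longrightarrow> E \<noteq> F \<Longrightarrow> E face_of (convex hull (insert v P))"
    and "\<And>E. E face_of F \<Longrightarrow> E \<noteq> F \<Longrightarrow> (convex hull (insert v E)) face_of (convex hull (insert v P))"
    and "\<And>x. x \<in> P \<Longrightarrow> x \<notin> F \<Longrightarrow> \<not> (convex hull {v, x}) face_of (convex hull (insert v P))"
proof -
  have conv: "convex P" and poly: "polyhedron P"
    using P(1) by (auto simp: polytope_imp_convex polytope_imp_polyhedron)
  have F_face: "F face_of P" and F_ne: "F \<noteq> {}" and F_dim: "aff_dim F = DIM('a) - 1"
    using F P(2) by (auto simp: facet_of_def)
  have F_sub: "F \<subseteq> P" and F_conv: "convex F"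
    using F_face by (auto simp: face_of_imp_subset face_of_imp_convex)
  have P_ne: "P \<noteq> {}"
    using F_ne F_sub by auto
  have FP: "F \<noteq> P"
    using F_dim P(2) by auto
  obtain z where z: "z \<in> rel_interior F"
    using F_ne F_conv rel_interior_eq_empty by blast
  have zF: "z \<in> F"
    using z rel_interior_subset by blast
  \<comment> \<open>The apex will be \<open>z + t *\<^sub>R (z - q)\<close>: coming from
    \<open>q\<close> in \<open>P\<close> and passing through \<open>z\<close>, the line leaves
    \<open>P\<close> across the hyperplane of \<open>F\<close>. As \<open>z\<close> is in the
    relative interior of \<open>F\<close>, it lies in no proper face of \<open>P\<close> but
    \<open>F\<close>, so small \<open>t\<close> violates no other strict inequality.\<close>
  obtain q where q: "q \<in> P" "q \<notin> F"
    using F_sub FP by blast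
  obtain H where H: "finite H" "P = affine hull P \<inter> \<Inter>H"
    "\<And>h. h \<in> H \<Longrightarrow> \<exists>a b. a \<noteq> 0 \<and> h = {x. a \<bullet> x \<le> b}"
    "\<And>H'. H' \<subset> H \<Longrightarrow> P \<subset> affine hull P \<inter> \<Inter>H'"
    using poly by (simp add: polyhedron_Int_affine_minimal) meson
  then obtain a b where ab: "\<And>h. h \<in> H \<Longrightarrow> a h \<noteq> 0 \<and> h = {x. a h \<bullet> x \<le> b h}"
    by metis
  have facets: "G facet_of P \<longleftrightarrow> (\<exists>h. h \<in> H \<and> G = P \<inter> {x. a h \<bullet> x = b h})" for G
    by (rule facet_of_polyhedron_explicit[OF H(1,2) ab H(4)])
  have PH: "x \<in> P \<longleftrightarrow> (\<forall>h\<in>H. a h \<bullet> x \<le> b h)" for x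
  proof -
    have "affine hull P = UNIV"
      using P(2) aff_dim_eq_full by blast
    then show ?thesis
      using H(2) ab by auto
  qed
  obtain h0 where h0: "h0 \<in> H" "F = P \<inter> {x. a h0 \<bullet> x = b h0}"
    using F facets by blast
  define c where "c = a h0"
  define e where "e = b h0"
  have F_eq: "F = P \<inter> {x. c \<bullet> x = e}" and Pc: "P \<subseteq> {x. c \<bullet> x \<le> e}" and c0: "c \<noteq> 0"
    using h0 PH ab by (auto simp: c_def e_def)
  have aff_hull: "affine hull F = {x. c' \<bullet> x = e'}" if "c' \<noteq> 0" "F \<subseteq> {x. c' \<bullet> x = e'}" for c' e'
  proof -
    have "affine hull F \<subseteq> {x. c' \<bullet> x = e'}"
      using that by (intro hull_minimal affine_hyperplane) auto
    moreover have "aff_dim (affine hull F) = aff_dim {x. c' \<bullet> x = e'}"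
      using F_dim that by (simp add: aff_dim_hyperplane)
    ultimately show ?thesis
      using F_ne by (intro affine_dim_equal affine_affine_hull affine_hyperplane) auto
  qed
  \<comment> \<open>One exposing hyperplane is fixed for every proper face except \<open>F\<close>,
    not just for the facets. Finitely many strict inequalities at \<open>z\<close> persist for small
    \<open>t\<close>, and each one directly makes its face survive in the new hull.\<close>
  define \<E> where "\<E> = {E. E face_of P \<and> E \<noteq> P \<and> E \<noteq> F}"
  have finE: "finite \<E>"
    unfolding \<E>_def using finite_polytope_faces[OF P(1)] by (rule rev_finite_subset) auto
  have "\<exists>n k. P \<subseteq> {x. n \<bullet> x \<le> k} \<and> E = P \<inter> {x. n \<bullet> x = k} \<and> (E \<noteq> {} \<longrightarrow> n \<noteq> 0)" if "E \<in> \<E>" for E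
  proof (cases "E = {}")
    \<comment> \<open>The empty face gets the functional 0 with bound 1, whose inequality
      \<open>0 < 1\<close> holds at every point.\<close>
    case True
    then show ?thesis
      by (intro exI[of _ 0] exI[of _ 1]) auto
  next
    case False
    have "E exposed_face_of P"
      using that exposed_face_of_polyhedron[OF poly] by (auto simp: \<E>_def)
    then show ?thesis
      using that False unfolding exposed_face_of \<E>_def by blast
  qed
  then obtain n k where nk: "\<And>E. E \<in> \<E> \<Longrightarrow> P \<subseteq> {x. n E \<bullet> x \<le> k E} \<and> E = P \<inter> {x. n E \<bullet> x = k E} \<and>
      (E \<noteq> {} \<longrightarrow> n E \<noteq> 0)"
    by metis
  have nz: "n E \<bullet> z < k E" if "E \<in> \<E>" for E
  proof -
    have "z \<notin> E"
    proof
      assume "z \<in> E"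
      then have "F \<subseteq> E"
        using subset_of_face_of[of E P F] that z F_sub by (auto simp: \<E>_def)
      then show False
        using face_containing_facet[OF conv F] that by (auto simp: \<E>_def)
    qed
    moreover have "n E \<bullet> z \<le> k E" "E = P \<inter> {x. n E \<bullet> x = k E}"
      using nk[OF that] zF F_sub by auto
    ultimately show ?thesis
      using zF F_sub by force
  qed
  have hz: "a h \<bullet> z < b h" if "h \<in> H" "P \<inter> {x. a h \<bullet> x = b h} \<noteq> F" for h
  proof -
    let ?G = "P \<inter> {x. a h \<bullet> x = b h}"
    have G: "?G facet_of P"
      using that facets by blast
    have "z \<notin> ?G"
    proof
      assume "z \<in> ?G"
      then have "F \<subseteq> ?G"
        using subset_of_face_of[of ?G P F] facet_of_imp_face_of[OF G] z F_sub by auto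
      then show False
        using face_containing_facet[OF conv F facet_of_imp_face_of[OF G]] that G by auto
    qed
    moreover have "a h \<bullet> z \<le> b h"
      using PH zF F_sub that by blast
    ultimately show ?thesis
      using zF F_sub by force
  qed
  have near: "\<forall>\<^sub>F t in at_right 0. m \<bullet> (z + t *\<^sub>R (z - q)) < l" if "m \<bullet> z < l" for m l
  proof -
    have "((\<lambda>t. m \<bullet> (z + t *\<^sub>R (z - q))) \<longlongrightarrow> m \<bullet> (z + 0 *\<^sub>R (z - q))) (at_right 0)"
      by (intro tendsto_intros)
    then show ?thesis
      using that by (auto dest: order_tendstoD(2)[where a = l])
  qed
  have "\<forall>\<^sub>F t in at_right 0. \<forall>E\<in>\<E>. n E \<bullet> (z + t *\<^sub>R (z - q)) < k E"
    using finE nz near by (intro eventually_ball_finite) auto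
  moreover have "\<forall>\<^sub>F t in at_right 0. \<forall>h\<in>{h\<in>H. P \<inter> {x. a h \<bullet> x = b h} \<noteq> F}. a h \<bullet> (z + t *\<^sub>R (z - q)) < b h"
    using H(1) hz near by (intro eventually_ball_finite) auto
  moreover have "\<forall>\<^sub>F t in at_right 0. (t::real) > 0"
    by (simp add: eventually_at_right_less)
  ultimately have "\<forall>\<^sub>F t in at_right 0. (t::real) > 0 \<and> (\<forall>E\<in>\<E>. n E \<bullet> (z + t *\<^sub>R (z - q)) < k E) \<and>
      (\<forall>h\<in>{h\<in>H. P \<inter> {x. a h \<bullet> x = b h} \<noteq> F}. a h \<bullet> (z + t *\<^sub>R (z - q)) < b h)"
    by eventually_elim blast
  then have "\<exists>t::real. t > 0 \<and> (\<forall>E\<in>\<E>. n E \<bullet> (z + t *\<^sub>R (z - q)) < k E) \<and>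
      (\<forall>h\<in>{h\<in>H. P \<inter> {x. a h \<bullet> x = b h} \<noteq> F}. a h \<bullet> (z + t *\<^sub>R (z - q)) < b h)"
    by (rule eventually_happens'[OF trivial_limit_at_right_real])
  then obtain t :: real where t: "t > 0" "\<And>E. E \<in> \<E> \<Longrightarrow> n E \<bullet> (z + t *\<^sub>R (z - q)) < k E"
    "\<And>h. h \<in> H \<Longrightarrow> P \<inter> {x. a h \<bullet> x = b h} \<noteq> F \<Longrightarrow> a h \<bullet> (z + t *\<^sub>R (z - q)) < b h"
    by blast
  define v where "v = z + t *\<^sub>R (z - q)"
  have nv: "n E \<bullet> v < k E" if "E \<in> \<E>" for E
    using t(2)[OF that] by (simp add: v_def)
  have hv: "a h \<bullet> v < b h" if "h \<in> H" "P \<inter> {x. a h \<bullet> x = b h} \<noteq> F" for h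
    using t(3)[OF that] by (simp add: v_def)
  have "c \<bullet> q < e" "c \<bullet> z = e"
    using q zF F_eq Pc by force+
  then have cv: "c \<bullet> v > e"
    using t(1) by (simp add: v_def inner_add_right inner_diff_right)
  have faceE: "E face_of (convex hull (insert v P))" if "E \<in> \<E>" for E
    using face_of_insert_point_beneath[OF conv P_ne] nk[OF that] nv[OF that] by blast
  show thesis
  proof
    show "beyond_facet v F P"
      unfolding beyond_facet_def using c0 Pc F_eq cv by blast
    show "beneath_facet v G P" if "G facet_of P" "G \<noteq> F" for G
    proof -
      have "G \<in> \<E>" "G \<noteq> {}"
        using that by (auto simp: \<E>_def facet_of_def)
      then show ?thesis
        unfolding beneath_facet_def using nk nv by blast
    qed
    show "v \<notin> affine hull F"
    proof -
      have "affine hull F = {x. c \<bullet> x = e}"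
        using c0 F_eq by (intro aff_hull) auto
      then show ?thesis
        using cv by simp
    qed
    show "v \<notin> P"
      using cv Pc by auto
    show "E face_of (convex hull (insert v P))" if "E face_of P" "E \<noteq> P" "E \<noteq> F" for E
      using faceE that by (simp add: \<E>_def)
    show "(convex hull (insert v E)) face_of (convex hull (insert v P))" if "E face_of F" "E \<noteq> F" for E
    proof -
      have sub: "E \<subseteq> F" and face: "E face_of P"
        using face_of_imp_subset[OF that(1)] face_of_trans[OF that(1) F_face] by auto
      have "E \<noteq> P"
        using sub F_sub FP by blast
      then have "E \<in> \<E>"
        using face that by (simp add: \<E>_def)
      then show ?thesis
        using face_of_cone_over_subface[OF conv P_ne _ _ F_eq Pc _ cv sub] nk nv by blast
    qed
    show "\<not> (convex hull {v, x}) face_of (convex hull (insert v P))" if "x \<in> P" "x \<notin> F" for x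
    proof
      assume face: "(convex hull {v, x}) face_of (convex hull (insert v P))"
      have cx: "c \<bullet> x < e"
        using that F_eq Pc by force
      \<comment> \<open>\<open>s\<close> is the parameter at which the segment from \<open>v\<close>
        to \<open>x\<close> meets the hyperplane of \<open>F\<close>. The crossing point
        \<open>y\<close> lies in \<open>P\<close>, hence in \<open>F\<close>. If the segment were a
        face, \<open>{y}\<close> would be a face of \<open>F\<close>, then of \<open>P\<close>, then
        of the new hull, although \<open>y\<close> is interior to the segment.\<close>
      define s where "s = (c \<bullet> v - e) / (c \<bullet> v - c \<bullet> x)"
      have s: "0 < s" "s < 1"
        using cx cv by (auto simp: s_def)
      define y where "y = (1 - s) *\<^sub>R v + s *\<^sub>R x"
      have "c \<bullet> y = c \<bullet> v - s * (c \<bullet> v - c \<bullet> x)"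
        by (simp add: y_def inner_add_right algebra_simps)
      then have cy: "c \<bullet> y = e"
        using cx cv by (simp add: s_def)
      have "a h \<bullet> y \<le> b h" if h: "h \<in> H" for h
      proof (cases "P \<inter> {x. a h \<bullet> x = b h} = F")
        case True
        then have "{x. c \<bullet> x = e} = {x. a h \<bullet> x = b h}"
          using aff_hull[OF c0] aff_hull[of "a h" "b h"] ab[OF h] F_eq by blast
        then have "a h \<bullet> y = b h"
          using cy by blast
        then show ?thesis
          by simp
      next
        case False
        have "a h \<bullet> v \<le> b h" "a h \<bullet> x \<le> b h"
          using hv[OF h False] PH \<open>x \<in> P\<close> h by auto
        then show ?thesis
          using s unfolding y_def by (simp add: inner_add_right convex_bound_le)
      qed
      then have yF: "y \<in> F"
        using PH F_eq cy by blast
      have y_seg: "y \<in> open_segment v x"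
        using s cx cv unfolding y_def in_segment by (intro conjI exI[of _ s]) auto
      have "(convex hull {v, x} \<inter> F) \<subseteq> {y}"
      proof
        fix w assume w: "w \<in> convex hull {v, x} \<inter> F"
        then obtain r where r: "w = (1 - r) *\<^sub>R v + r *\<^sub>R x"
          by (auto simp: segment_convex_hull[symmetric] in_segment)
        have "c \<bullet> w = c \<bullet> v - r * (c \<bullet> v - c \<bullet> x)"
          by (simp add: r inner_add_right algebra_simps)
        then have "r = s"
          using w F_eq cx cv by (simp add: s_def field_simps)
        then show "w \<in> {y}"
          by (simp add: r y_def)
      qed
      moreover have "y \<in> convex hull {v, x}"
        using y_seg open_closed_segment segment_convex_hull by blast
      ultimately have eq: "convex hull {v, x} \<inter> F = {y}"
        using yF by auto
      have "F \<subseteq> convex hull (insert v P)"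
        using F_sub hull_subset[of "insert v P" convex] by blast
      then have "{y} face_of F"
        using face_of_slice[OF face F_conv] eq by (simp add: Int_absorb1)
      then have y_face: "{y} face_of P"
        using F_face face_of_trans by blast
      \<comment> \<open>From dimension 2 on a facet is not a single point, so \<open>{y}\<close> is
        among the faces that survive.\<close>
      have "aff_dim {y} \<noteq> aff_dim F" "aff_dim {y} \<noteq> aff_dim P"
        using F_dim P(2) dim by auto
      then have "{y} \<in> \<E>"
        using y_face by (auto simp: \<E>_def)
      then have "{y} face_of convex hull (insert v P)"
        by (rule faceE)
      then have "v = y"
        using y_seg face_ofD[of "{y}" "convex hull (insert v P)" y v x] \<open>x \<in> P\<close>
        by (simp add: hull_inc)
      then show False
        using cy cv by simp
    qed
  qed
qed


text \<open>The effect of stacking in terms of vertex labels: \<open>F\<close> disappears, all other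
  facets survive, and the cones over the ridges of the simplex \<open>F\<close> become facets, one
  for each deleted vertex \<open>t\<close>.\<close>

lemma stacking_facet_vertices:
  fixes P :: "'a::euclidean_space set"
  assumes P: "polytope P" "aff_dim P = DIM('a)" and dim: "DIM('a) \<ge> 3"
    and f: "bij_betw f S {x. x extreme_point_of P}"
    and T: "T \<subseteq> S" "card T = DIM('a)" and F: "convex hull (f ` T) facet_of P" and B: "B \<notin> S"
  obtains v where "beyond_facet v (convex hull (f ` T)) P"
    and "\<And>G. G facet_of P \<Longrightarrow> G \<noteq> convex hull (f ` T) \<Longrightarrow> beneath_facet v G P"
    and "polytope (convex hull (insert v P))" and "aff_dim (convex hull (insert v P)) = DIM('a)"
    and "bij_betw (f(B := v)) (insert B S) {x. x extreme_point_of (convex hull (insert v P))}"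
    and "\<And>A A'. A \<in> S \<Longrightarrow> A' \<in> S \<Longrightarrow>
      (convex hull {f A, f A'}) edge_of (convex hull (insert v P)) \<longleftrightarrow> (convex hull {f A, f A'}) edge_of P"
    and "\<And>A. A \<in> S \<Longrightarrow> (convex hull {v, f A}) edge_of (convex hull (insert v P)) \<longleftrightarrow> A \<in> T"
    and "\<And>U. U \<subseteq> S \<Longrightarrow> U \<noteq> T \<Longrightarrow> convex hull (f ` U) facet_of P \<Longrightarrow>
      convex hull (f ` U) facet_of (convex hull (insert v P))"
    and "\<And>t. t \<in> T \<Longrightarrow> convex hull (insert v (f ` (T - {t}))) facet_of (convex hull (insert v P))"
proof -
  let ?F = "convex hull (f ` T)"
  have "DIM('a) \<ge> 2"
    using dim by simp
  from stacking_point_exists[OF P F this] obtain v where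
    v: "beyond_facet v ?F P" "\<And>G. G facet_of P \<Longrightarrow> G \<noteq> ?F \<Longrightarrow> beneath_facet v G P"
      "v \<notin> affine hull ?F" "v \<notin> P"
    and old: "\<And>E. E face_of P \<Longrightarrow> E \<noteq> P \<Longrightarrow> E \<noteq> ?F \<Longrightarrow> E face_of (convex hull (insert v P))"
    and new: "\<And>E. E face_of ?F \<Longrightarrow> E \<noteq> ?F \<Longrightarrow>
      (convex hull (insert v E)) face_of (convex hull (insert v P))"
    and nonedge: "\<And>x. x \<in> P \<Longrightarrow> x \<notin> ?F \<Longrightarrow> \<not> (convex hull {v, x}) face_of (convex hull (insert v P))"
    by blast
  let ?Q = "convex hull (insert v P)"
  let ?X = "{x. x extreme_point_of P}"
  have fS: "f ` S = ?X" and inj: "inj_on f S"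
    using f by (auto simp: bij_betw_def)
  have finX: "finite ?X"
    using P(1) polytope_imp_polyhedron finite_polyhedron_extreme_points by blast
  have PX: "P = convex hull ?X"
    using P(1) Krein_Milman_polytope unfolding polytope_def by blast
  have finT: "finite T"
    using T dim card_ge_0_finite[of T] by simp
  have injT: "inj_on f T"
    using inj T(1) by (rule inj_on_subset)
  have F_dim: "aff_dim ?F = int DIM('a) - 1"
    using F P(2) by (simp add: facet_of_def)
  have F_face: "?F face_of P"
    using F by (rule facet_of_imp_face_of)
  \<comment> \<open>\<open>DIM('a)\<close> points spanning dimension \<open>DIM('a) - 1\<close> are
    the vertices of a simplex.\<close>
  have indep: "\<not> affine_dependent (f ` T)"
    using F_dim finT T(2) card_image[OF injT]
    by (simp add: affine_independent_iff_card aff_dim_convex_hull)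
  have Q: "?Q = convex hull (insert v ?X)"
    using hull_insert[of convex v ?X] unfolding PX[symmetric] by simp
  have QP: "P \<subseteq> ?Q"
    by (meson hull_subset order_trans subset_insertI)
  have Q_poly: "polytope ?Q"
    unfolding Q using finX by (intro polytope_convex_hull) simp
  have Q_dim: "aff_dim ?Q = DIM('a)"
    using aff_dim_subset[OF QP] aff_dim_le_DIM[of ?Q] P(2) by simp
  have vert: "f A \<in> P" "f A extreme_point_of P" if "A \<in> S" for A
    using that fS by (auto simp: extreme_point_of_def)
  have in_F: "f A \<in> ?F \<longleftrightarrow> A \<in> T" if "A \<in> S" for A
  proof
    assume "f A \<in> ?F"
    then have "f A extreme_point_of ?F"
      using vert[OF that] F_face by (simp add: extreme_point_of_face)
    then have "f A \<in> f ` T"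
      by (rule extreme_point_of_convex_hull)
    then show "A \<in> T"
      using inj that T by (auto simp: inj_on_def)
  qed (simp add: hull_inc)
  \<comment> \<open>Applies to vertices and edges; for edges the dimension bound 3 ensures that an
    edge is not itself a facet.\<close>
  have old_face: "E face_of ?Q" if "E face_of P" "aff_dim E < int DIM('a) - 1" for E
  proof (rule old[OF that(1)])
    show "E \<noteq> P" "E \<noteq> ?F"
      using that(2) F_dim P(2) by auto
  qed
  have ext_Q: "{x. x extreme_point_of ?Q} = insert v ?X"
  proof
    show "{x. x extreme_point_of ?Q} \<subseteq> insert v ?X"
      unfolding Q using extreme_point_of_convex_hull by blast
    have "v extreme_point_of ?Q"
      unfolding Q using finX v(4) PX by (intro extreme_point_of_convex_hull_insert) auto
    moreover have "x extreme_point_of ?Q" if "x extreme_point_of P" for x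
      using old_face[of "{x}"] that dim by (simp add: face_of_singleton)
    ultimately show "insert v ?X \<subseteq> {x. x extreme_point_of ?Q}"
      by blast
  qed
  show thesis
  proof
    show "beyond_facet v ?F P"
      by (rule v)
    show "beneath_facet v G P" if "G facet_of P" "G \<noteq> ?F" for G
      using v that by blast
    show "polytope ?Q" "aff_dim ?Q = DIM('a)"
      by (rule Q_poly Q_dim)+
    have "v \<notin> ?X"
      using v(4) by (auto simp: extreme_point_of_def)
    then show "bij_betw (f(B := v)) (insert B S) {x. x extreme_point_of ?Q}"
      unfolding ext_Q using f B by (auto simp: bij_betw_def inj_on_def)
    show "(convex hull {f A, f A'}) edge_of ?Q \<longleftrightarrow> (convex hull {f A, f A'}) edge_of P"
      if "A \<in> S" "A' \<in> S" for A A'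
    proof
      assume e: "(convex hull {f A, f A'}) edge_of ?Q"
      have "convex hull {f A, f A'} \<subseteq> P"
        using vert that P(1) by (intro hull_minimal polytope_imp_convex) auto
      then show "(convex hull {f A, f A'}) edge_of P"
        using e QP face_of_subset unfolding edge_of_def by blast
    next
      assume "(convex hull {f A, f A'}) edge_of P"
      then show "(convex hull {f A, f A'}) edge_of ?Q"
        using old_face[of "convex hull {f A, f A'}"] dim unfolding edge_of_def by simp
    qed
    show "(convex hull {v, f A}) edge_of ?Q \<longleftrightarrow> A \<in> T" if "A \<in> S" for A
    proof
      assume "(convex hull {v, f A}) edge_of ?Q"
      then show "A \<in> T"
        using nonedge vert[OF that] in_F[OF that] by (auto simp: edge_of_def)
    next
      assume A: "A \<in> T"
      have "{f A} face_of ?F"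
        using A by (auto simp: face_of_convex_hull_affine_independent[OF indep] intro!: exI[of _ "{f A}"])
      moreover have "{f A} \<noteq> ?F"
        using F_dim dim aff_dim_sing[of "f A"] by force
      ultimately have "(convex hull {v, f A}) face_of ?Q"
        by (rule new)
      moreover have "v \<noteq> f A"
        using v(4) vert[OF that] by blast
      then have "aff_dim (convex hull {v, f A}) = 1"
        by (simp add: aff_dim_convex_hull aff_dim_2)
      ultimately show "(convex hull {v, f A}) edge_of ?Q"
        by (simp add: edge_of_def)
    qed
    show "convex hull (f ` U) facet_of ?Q"
      if U: "U \<subseteq> S" "U \<noteq> T" "convex hull (f ` U) facet_of P" for U
    proof -
      have ne: "convex hull (f ` U) \<noteq> ?F"
      proof
        assume eq: "convex hull (f ` U) = ?F"
        have "U \<subseteq> T"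
          using in_F U(1) hull_subset[of "f ` U" convex] unfolding eq by blast
        then have "U \<subset> T"
          using U(2) by blast
        then have "card U < DIM('a)" and finU: "finite U"
          using psubset_card_mono[OF finT] T(2) finT finite_subset by auto
        then have "int (card (f ` U)) - 1 < int DIM('a) - 1"
          using card_image_le[of U f] by simp
        then show False
          using aff_dim_le_card[of "f ` U"] F_dim eq finU aff_dim_convex_hull[of "f ` U"] by simp
      qed
      have "convex hull (f ` U) \<noteq> P"
        using U(3) by auto
      then have "convex hull (f ` U) face_of ?Q"
        using old U(3) ne by (simp add: facet_of_def)
      then show ?thesis
        using U(3) P(2) Q_dim by (simp add: facet_of_def)
    qed
    show "convex hull (insert v (f ` (T - {t}))) facet_of ?Q" if t: "t \<in> T" for t
    proof -
      let ?E = "convex hull (f ` (T - {t}))"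
      have ind: "\<not> affine_dependent (f ` (T - {t}))"
        using indep affine_dependent_subset by (metis Diff_subset image_mono)
      have card: "card (f ` (T - {t})) = DIM('a) - 1"
        using t finT T(2) by (subst card_image) (auto intro: inj_on_subset[OF injT])
      then have E_dim: "aff_dim ?E = int DIM('a) - 2"
        using aff_dim_affine_independent[OF ind] dim by (simp add: aff_dim_convex_hull)
      have "?E face_of ?F"
        unfolding face_of_convex_hull_affine_independent[OF indep]
        by (intro exI[of _ "f ` (T - {t})"] conjI refl image_mono Diff_subset)
      moreover have "?E \<noteq> ?F"
        using E_dim F_dim by auto
      ultimately have "(convex hull (insert v ?E)) face_of ?Q"
        by (rule new)
      then have face: "convex hull (insert v (f ` (T - {t}))) face_of ?Q"
        by (simp only: hull_insert[of convex v "f ` (T - {t})"])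
      have "affine hull (f ` (T - {t})) \<subseteq> affine hull ?F"
        by (metis Diff_subset affine_hull_convex_hull hull_mono image_mono)
      then have "v \<notin> affine hull (f ` (T - {t}))"
        using v(3) by blast
      then have "aff_dim (insert v (f ` (T - {t}))) = int DIM('a) - 1"
        using E_dim by (simp add: aff_dim_insert aff_dim_convex_hull)
      then show ?thesis
        using face Q_dim by (simp add: facet_of_def aff_dim_convex_hull)
    qed
  qed
qed

section \<open>Realizing the tree of cliques by a stacked polytope\<close>

text \<open>The last clause makes the induction work. The members of \<open>\<D>\<close> play the
  role of the simplices glued together, and a \<open>DIM('a)\<close>-subset lying in only one of
  them is exposed on the boundary, so the next vertex can be stacked there.\<close>

definition polytope_realizes ::
  "(real^'n) option set set \<Rightarrow> (real^'n) option set set set \<Rightarrow> ((real^'n) option set \<Rightarrow> 'a::euclidean_space) \<Rightarrow> 'a set \<Rightarrow> bool"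
where
  "polytope_realizes S \<D> f P \<longleftrightarrow> polytope P \<and> aff_dim P = DIM('a) \<and>
     bij_betw f S {x. x extreme_point_of P} \<and>
     (\<forall>A\<in>S. \<forall>B\<in>S. A \<noteq> B \<longrightarrow> (tangent A B \<longleftrightarrow> (convex hull {f A, f B}) edge_of P)) \<and>
     (\<forall>T. card T = DIM('a) \<longrightarrow> (\<exists>!\<Delta>. \<Delta> \<in> \<D> \<and> T \<subseteq> \<Delta>) \<longrightarrow> convex hull (f ` T) facet_of P)"

lemma simplex_realizes:
  fixes D :: "(real^'n) option set set"
  assumes D: "card D = DIM(real^'m) + 1" "pairwise tangent D" and dim: "DIM(real^'m) \<ge> 1"
  obtains f and P :: "(real^'m) set" where "stacked_polytope P" "polytope_realizes D {D} f P"
proof -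
  let ?V = "insert 0 Basis :: (real^'m) set"
  have V: "\<not> affine_dependent ?V"
    using affine_dependent_imp_dependent2 independent_Basis by blast
  have card_V: "card ?V = DIM(real^'m) + 1"
    by simp
  have finD: "finite D"
    using D card_ge_0_finite[of D] by simp
  have "card D = card ?V"
    using D card_V by simp
  then obtain f where f: "bij_betw f D ?V"
    using finite_same_card_bij[OF finD finite_insert[THEN iffD2, OF finite_Basis]] by blast
  have fD: "f ` D = ?V" and inj: "inj_on f D"
    using f by (simp_all only: bij_betw_def)
  let ?P = "convex hull ?V"
  have faces: "convex hull (f ` U) face_of ?P" if "U \<subseteq> D" for U
  proof -
    have "f ` U \<subseteq> ?V"
      using image_mono[OF that, of f] unfolding fD .
    then show ?thesis
      unfolding face_of_convex_hull_affine_independent[OF V] by (intro exI[of _ "f ` U"] conjI refl)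
  qed
  have P_dim: "aff_dim ?P = DIM(real^'m)"
    using aff_dim_affine_independent[OF V] card_V by (simp add: aff_dim_convex_hull)
  have U_dim: "aff_dim (convex hull (f ` U)) = int (card U) - 1" if "U \<subseteq> D" for U
  proof -
    have "\<not> affine_dependent (f ` U)"
      using V that fD affine_dependent_subset by (metis image_mono)
    then show ?thesis
      using card_image[OF inj_on_subset[OF inj that]] aff_dim_affine_independent[of "f ` U"]
      by (simp add: aff_dim_convex_hull)
  qed
  show thesis
  proof
    show "stacked_polytope ?P"
      using V card_V by (intro stacked_polytope.simplex) auto
    have "{x. x extreme_point_of ?P} = ?V"
      using extreme_point_of_convex_hull_affine_independent[OF V] by auto
    moreover have "tangent A B \<longleftrightarrow> (convex hull {f A, f B}) edge_of ?P"
      if "A \<in> D" "B \<in> D" "A \<noteq> B" for A B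
      using that D(2) faces[of "{A, B}"] U_dim[of "{A, B}"] by (simp add: edge_of_def pairwise_def)
    moreover have "convex hull (f ` T) facet_of ?P"
      if "card T = DIM(real^'m)" "\<exists>!\<Delta>. \<Delta> \<in> {D} \<and> T \<subseteq> \<Delta>" for T
    proof -
      have "T \<subseteq> D" "T \<noteq> {}"
        using that dim by auto
      then show ?thesis
        using faces U_dim that P_dim by (simp add: facet_of_def)
    qed
    moreover have "polytope ?P"
      by (intro polytope_convex_hull) simp
    ultimately show "polytope_realizes D {D} f ?P"
      unfolding polytope_realizes_def using f P_dim by auto
  qed
qed

lemma stacking_realizes:
  fixes S :: "(real^'n) option set set" and P :: "(real^'m) set"
  assumes real: "polytope_realizes S \<D> f P" and stacked: "stacked_polytope P"
    and dim: "DIM(real^'m) \<ge> 3" and union: "\<Union>\<D> = S"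
    and B: "B \<notin> S" and T: "T \<subseteq> S" "card T = DIM(real^'m)" and ex1: "\<exists>!\<Delta>. \<Delta> \<in> \<D> \<and> T \<subseteq> \<Delta>"
    and nbrs: "\<And>A. A \<in> S \<Longrightarrow> tangent A B \<longleftrightarrow> A \<in> T"
  obtains g and Q :: "(real^'m) set"
    where "stacked_polytope Q" "polytope_realizes (insert B S) (insert (insert B T) \<D>) g Q"
proof -
  have P: "polytope P" "aff_dim P = DIM(real^'m)" and f: "bij_betw f S {x. x extreme_point_of P}"
    and edges: "\<And>A B. \<lbrakk> A \<in> S; B \<in> S; A \<noteq> B \<rbrakk> \<Longrightarrow>
      tangent A B \<longleftrightarrow> (convex hull {f A, f B}) edge_of P"
    and facets: "\<And>T. \<lbrakk> card T = DIM(real^'m); \<exists>!\<Delta>. \<Delta> \<in> \<D> \<and> T \<subseteq> \<Delta> \<rbrakk> \<Longrightarrow> convex hull (f ` T) facet_of P"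
    using real by (simp_all add: polytope_realizes_def)
  have F: "convex hull (f ` T) facet_of P"
    by (rule facets[OF T(2) ex1])
  from stacking_facet_vertices[OF P dim f T F B] obtain v where
    v: "beyond_facet v (convex hull (f ` T)) P"
      "\<And>G. G facet_of P \<Longrightarrow> G \<noteq> convex hull (f ` T) \<Longrightarrow> beneath_facet v G P"
      "polytope (convex hull (insert v P))" "aff_dim (convex hull (insert v P)) = DIM(real^'m)"
      "bij_betw (f(B := v)) (insert B S) {x. x extreme_point_of (convex hull (insert v P))}"
    and old_edges: "\<And>A A'. A \<in> S \<Longrightarrow> A' \<in> S \<Longrightarrow>
      (convex hull {f A, f A'}) edge_of (convex hull (insert v P)) \<longleftrightarrow> (convex hull {f A, f A'}) edge_of P"
    and new_edges: "\<And>A. A \<in> S \<Longrightarrow>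
      (convex hull {v, f A}) edge_of (convex hull (insert v P)) \<longleftrightarrow> A \<in> T"
    and old_facets: "\<And>U. U \<subseteq> S \<Longrightarrow> U \<noteq> T \<Longrightarrow> convex hull (f ` U) facet_of P \<Longrightarrow>
      convex hull (f ` U) facet_of (convex hull (insert v P))"
    and new_facets: "\<And>t. t \<in> T \<Longrightarrow>
      convex hull (insert v (f ` (T - {t}))) facet_of (convex hull (insert v P))"
    by blast
  let ?Q = "convex hull (insert v P)" and ?g = "f(B := v)" and ?\<D> = "insert (insert B T) \<D>"
  have g: "?g ` U = f ` U" if "B \<notin> U" for U
    using that by auto
  have BT: "B \<notin> T"
    using B T by blast
  have finT: "finite T"
    using T dim card_ge_0_finite[of T] by simp
  show thesis
  proof
    show "stacked_polytope ?Q"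
      using v(2) by (intro stacked_polytope.stack[OF stacked F v(1)]) blast
    have "tangent A A' \<longleftrightarrow> (convex hull {?g A, ?g A'}) edge_of ?Q"
      if AA: "A \<in> insert B S" "A' \<in> insert B S" "A \<noteq> A'" for A A'
    proof -
      consider "A \<in> S" "A' \<in> S" | "A = B" "A' \<in> S" | "A \<in> S" "A' = B"
        using AA by blast
      then show ?thesis
      proof cases
        case 1
        then have "A \<noteq> B" "A' \<noteq> B"
          using B by auto
        then show ?thesis
          using 1 edges old_edges AA by simp
      next
        case 2
        then show ?thesis
          using nbrs[of A'] new_edges[of A'] AA tangent_commute[of B A'] by simp
      next
        case 3
        then show ?thesis
          using nbrs[of A] new_edges[of A] AA insert_commute[of "f A" v "{}"] by simp
      qed
    qed
    moreover have "convex hull (?g ` U) facet_of ?Q"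
      if U: "card U = DIM(real^'m)" "\<exists>!\<Delta>. \<Delta> \<in> ?\<D> \<and> U \<subseteq> \<Delta>" for U
    proof (cases "B \<in> U")
      case True
      then have "U \<subseteq> insert B T"
        using U(2) union B by blast
      then have sub: "U - {B} \<subseteq> T"
        by auto
      have "card (U - {B}) = DIM(real^'m) - 1"
        using U(1) True by simp
      then have "card (T - (U - {B})) = 1"
        using card_Diff_subset[OF finite_subset[OF sub finT] sub] T(2) dim by simp
      then obtain t where "T - (U - {B}) = {t}"
        by (auto simp: card_1_singleton_iff)
      then have t: "t \<in> T" "U - {B} = T - {t}"
        using sub by auto
      have "?g ` U = insert v (f ` (U - {B}))"
        using True by auto
      then show ?thesis
        using new_facets[OF t(1)] by (simp add: t(2))
    next
      case False
      \<comment> \<open>\<open>T\<close> is now contained in the new member as well as in an old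
        one, so it is no longer required to be a facet; it is the facet that stacking
        buries.\<close>
      have UT: "U \<noteq> T"
      proof
        assume "U = T"
        then obtain \<Delta> where "\<Delta> \<in> \<D>" "U \<subseteq> \<Delta>"
          using ex1 by blast
        moreover have "insert B T \<notin> \<D>"
          using union B by blast
        ultimately show False
          using U(2) \<open>U = T\<close> by blast
      qed
      have "\<not> U \<subseteq> insert B T"
      proof
        assume "U \<subseteq> insert B T"
        then have "U \<subseteq> T"
          using False by blast
        then show False
          using UT card_subset_eq[OF finT] U(1) T(2) by simp
      qed
      then have ex: "\<exists>!\<Delta>. \<Delta> \<in> \<D> \<and> U \<subseteq> \<Delta>"
        using U(2) by (metis insert_iff)
      then have "U \<subseteq> S"
        using union by blast
      then show ?thesis
        using old_facets UT facets[OF U(1) ex] by (simp only: g[OF False])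
    qed
    ultimately show "polytope_realizes (insert B S) ?\<D> ?g ?Q"
      unfolding polytope_realizes_def using v(3-5) by blast
  qed
qed

text \<open>The tree and the polytope must be built together over the same \<open>\<D>\<close>: the
  tree shows that \<open>T\<close> lies in one member only, and the polytope turns this into a
  facet. The type \<open>'n option\<close> supplies dimension \<open>d + 1\<close>, and the packing
  property of the larger collection restricts to each earlier stage.\<close>

lemma apollonian_realizes:
  fixes S :: "(real^'n) option set set"
  assumes "apollonian S" "ball_packing S" "CARD('n) > 3"
  shows "\<exists>\<D> f (P :: (real^('n option)) set).
    clique_tree S \<D> \<and> stacked_polytope P \<and> polytope_realizes S \<D> f P"
  using assms
proof (induction rule: apollonian.induct)
  case (start D)
  have D: "card D = CARD('n) + 2" "pairwise tangent D"
    using start by (auto simp: descartes_config_def)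
  have dim: "card D = DIM(real^('n option)) + 1" "DIM(real^('n option)) \<ge> 1"
    using D by auto
  obtain f and P :: "(real^('n option)) set" where "stacked_polytope P" "polytope_realizes D {D} f P"
    using simplex_realizes[OF dim(1) D(2) dim(2)] .
  moreover have "clique_tree D {D}"
    using D by (auto simp: clique_tree_def)
  ultimately show ?case
    by blast
next
  case (step S T B)
  have "ball_packing S"
    using step.prems by (auto intro: ball_packing_subset)
  then obtain \<D> f and P :: "(real^('n option)) set"
    where tree: "clique_tree S \<D>" and P: "stacked_polytope P" "polytope_realizes S \<D> f P"
    using step by blast
  note new = clique_tree_insert[OF step.prems(2) tree step.prems(1) step.hyps(6,2-4,7)]
  have dim: "DIM(real^('n option)) \<ge> 3" "card T = DIM(real^('n option))"
    using step.prems(2) step.hyps(3) by auto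
  have union: "\<Union>\<D> = S"
    using tree by (simp add: clique_tree_def)
  obtain g and Q :: "(real^('n option)) set" where "stacked_polytope Q"
    "polytope_realizes (insert B S) (insert (insert B T) \<D>) g Q"
    using stacking_realizes[OF P(2,1) dim(1) union step.hyps(6,2) dim(2) new(1,2)] .
  then show ?case
    using new(3) by (intro exI conjI)
qed

theorem theorem4p8:
  fixes Pk :: "(real^'n) option set set"
  assumes "CARD('n) > 3"
    and "finite Pk"
    and "ball_packing Pk"
    and "apollonian Pk"
  shows "\<exists>P :: (real^('n option)) set.
           stacked_polytope P \<and> tangency_graph_iso_polytope_graph Pk P"
proof -
  obtain \<D> f and P :: "(real^('n option)) set"
    where P: "stacked_polytope P" "polytope_realizes Pk \<D> f P"
    using apollonian_realizes[OF assms(4,3,1)] by blast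
  have "tangency_graph_iso_polytope_graph Pk P"
    unfolding tangency_graph_iso_polytope_graph_def
    using P(2) by (intro exI[of _ f]) (simp add: polytope_realizes_def)
  then show ?thesis
    using P(1) by blast
qed

end
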